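(* Let $\nabla$ be an Einstein's connection with $\nabla g=0$ on a manifold $(M,G=g+F)$, satisfying $$T(X,Y,Z)+T(X,Z,Y)+T(X,Z,fY)+T(X,Y,fZ)=0\qquad (X,Y,Z\in\mathfrak{X}_M).$$ Then the following Weitzenböck type decomposition formula is valid for any differential form $\omega\in\Lambda^k(M)$ (as an equality of $(0,k)$-tensors): $$\Delta^{f}_H\,\omega=\breve\nabla^{*f}\,\nabla^{f}\omega+\Re^{f}(\omega).$$
   Context: Setting. $M$ is a smooth $n$-dimensional manifold with a non-symmetric $(0,2)$-tensor $G=g+F$, where $g$ (the symmetric part) is a Riemannian metric and $F\neq0$ is the skew-symmetric part. $\nabla^g$ is the Levi-Civita connection of $g$, $\mathfrak{X}_M$ the smooth vector fields, $\Lambda^k(M)$ the differential $k$-forms. The $(1,1)$-tensor $f$ (skew-symmetric for $g$, not necessarily of constant rank) is defined by $g(X,fY)=F(X,Y)$. A linear connection $\nabla$ with torsion $T(X,Y)=\nabla_XY-\nabla_YX-[X,Y]$ is an Einstein's connection if $(\nabla_XG)(Y,Z)=-G(T(X,Y),Z)$ for all $X,Y,Z$. Write $T(X,Y,Z)=g(T(X,Y),Z)$. The difference tensor is $K_XY=\nabla_XY-\nabla^g_XY$; $K^*_X$ is the $g$-adjoint: $g(K^*_XY,Z)=g(Y,K_XZ)$. $f$-connection: $\nabla^f_XY=\nabla^g_{fX}Y+K_XY$; on functions $\nabla^f_X\psi=(fX)\psi$; on $(0,k)$-tensors $S$, $(\nabla^f S)(Y,X_1,\dots,X_k)=(fY)(S(X_1,\dots,X_k))-\sum_i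 S(X_1,\dots,\nabla^f_YX_i,\dots,X_k)$, and $\nabla^f_YS=(\nabla^fS)(Y,\dots)$. The dual $f$-connection $\breve\nabla^f$ is defined by $fX(g(Y,Z))=g(\nabla^f_XY,Z)+g(Y,\breve\nabla^f_XZ)$, i.e. $\breve\nabla^f_XY=\nabla^g_{fX}Y-K^*_XY$, and is extended to functions and tensors in the same way. With $\{e_i\}$ a local $g$-orthonormal frame, for a $(0,k+1)$-tensor $S$ set $(\breve\nabla^{*f}S)(X_1,\dots,X_k)=-\sum_i(\breve\nabla^f_{e_i}S)(e_i,X_1,\dots,X_k)$. Set $\breve\delta^f=\breve\nabla^{*f}$ on forms. Exterior $f$-derivative: $d^f\omega(X_0,\dots,X_k)=\sum_i(-1)^i(\nabla^f\omega)(X_i,X_0,\dots,X_{i-1},X_{i+1},\dots,X_k)$ for $\omega\in\Lambda^k(M)$. Hodge $f$-Laplacian: $\Delta^f_H=d^f\breve\delta^f+\breve\delta^fd^f$. Curvature: $[X,Y]_f=\nabla^f_XY-\nabla^f_YX$; $(\nabla^f)^2_{X,Y}S=\nabla^f_X(\nabla^f_YS)-\nabla^f_{\nabla^f_XY}S$; and $R^f_{X,Y}=(\nabla^f)^2_{X,Y}-(\nabla^f)^2_{Y,X}=\nabla^f_X\nabla^f_Y-\nabla^f_Y\nabla^f_X-\nabla^f_{[X,Y]_f}$, acting on tensors. The Weitzenböck $f$-curvature operator on $(0,k)$-tensors is $$\Re^f(S)(X_1,\dots,X_k)=\sum_{a=1}^k\sum_i(R^f_{e_i,X_a}S)(X_1,\dots,X_{a-1},e_i,X_{a+1},\dots,X_k).$$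 *)

theory Defs
  imports "HOL-Analysis.Analysis" "HOL-Library.Function_Algebras"
begin

section \<open>Smooth manifolds\<close>

text \<open>\<open>Ck_on k h S\<close> is the class $C^k$ on a set \<open>S\<close>; it is only used for open \<open>S\<close>.\<close>

primrec Ck_on ::
    "nat \<Rightarrow> ('a::euclidean_space \<Rightarrow> 'b::real_normed_vector) \<Rightarrow> 'a set \<Rightarrow> bool" where
  "Ck_on 0 h S \<longleftrightarrow> continuous_on S h"
| "Ck_on (Suc k) h S \<longleftrightarrow>
     h differentiable_on S \<and> (\<forall>v. Ck_on k (\<lambda>x. frechet_derivative h (at x) v) S)"

definition smooth_on ::
    "('a::euclidean_space \<Rightarrow> 'b::real_normed_vector) \<Rightarrow> 'a set \<Rightarrow> bool" where
  "smooth_on h S \<longleftrightarrow> (\<forall>k. Ck_on k h S)"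

text \<open>The points of the manifold are the elements of a Hausdorff second countable type
  \<open>'m\<close>; the charts take values in \<open>'e\<close>, so that the dimension is \<open>DIM('e)\<close>.\<close>

type_synonym ('m, 'e) atlas = "('m set \<times> ('m \<Rightarrow> 'e)) set"

definition smooth_manifold ::
    "('m::{t2_space,second_countable_topology}, 'e::euclidean_space) atlas \<Rightarrow> bool" where
  "smooth_manifold A \<longleftrightarrow>
     (\<Union>(U, \<phi>)\<in>A. U) = UNIV \<and>
     (\<forall>(U, \<phi>)\<in>A. open U \<and> open (\<phi> ` U) \<and> homeomorphism U (\<phi> ` U) \<phi> (inv_into U \<phi>)) \<and>
     (\<forall>(U, \<phi>)\<in>A. \<forall>(V, \<psi>)\<in>A. smooth_on (\<psi> \<circ> inv_into U \<phi>) (\<phi> ` (U \<inter> V)))"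

definition smooth_functions ::
    "('m::topological_space, 'e::euclidean_space) atlas \<Rightarrow> ('m \<Rightarrow> real) set" where
  "smooth_functions A = {\<psi>. \<forall>(U, \<phi>)\<in>A. smooth_on (\<psi> \<circ> inv_into U \<phi>) (\<phi> ` U)}"


section \<open>Vector fields and tensor fields\<close>

text \<open>Vector fields are the derivations of the algebra of smooth functions. They are set to
  \<open>0\<close> on non-smooth functions, so that equality in \<open>vector_fields A\<close> is equality of
  derivations. Sums, differences and products of functions are pointwise
  (\<^theory>\<open>HOL-Library.Function_Algebras\<close>).\<close>

type_synonym 'm vfield = "('m \<Rightarrow> real) \<Rightarrow> 'm \<Rightarrow> real"

definition vector_fields ::
    "('m::topological_space, 'e::euclidean_space) atlas \<Rightarrow> 'm vfield set" where
  "vector_fields A = {X.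
     (\<forall>\<psi>\<in>smooth_functions A. X \<psi> \<in> smooth_functions A) \<and>
     (\<forall>\<psi>. \<psi> \<notin> smooth_functions A \<longrightarrow> X \<psi> = 0) \<and>
     (\<forall>\<psi>\<in>smooth_functions A. \<forall>\<xi>\<in>smooth_functions A. X (\<psi> + \<xi>) = X \<psi> + X \<xi>) \<and>
     (\<forall>\<psi>\<in>smooth_functions A. \<forall>c. X ((\<lambda>_. c) * \<psi>) = (\<lambda>_. c) * X \<psi>) \<and>
     (\<forall>\<psi>\<in>smooth_functions A. \<forall>\<xi>\<in>smooth_functions A. X (\<psi> * \<xi>) = X \<psi> * \<xi> + \<psi> * X \<xi>)}"

definition fscale :: "('m \<Rightarrow> real) \<Rightarrow> 'm vfield \<Rightarrow> 'm vfield"  (infixr "\<odot>" 75) where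
  "\<psi> \<odot> X = (\<lambda>\<xi>. \<psi> * X \<xi>)"

definition lie_bracket :: "'m vfield \<Rightarrow> 'm vfield \<Rightarrow> 'm vfield" where
  "lie_bracket X Y = (\<lambda>\<psi>. X (Y \<psi>) - Y (X \<psi>))"

text \<open>A $(0,k)$-tensor is a \<open>C\<^sup>\<infinity>\<close>-multilinear map on \<open>k\<close>-tuples of vector
  fields, the tuples being lists of length \<open>k\<close>. Its values on other lists are irrelevant.\<close>

type_synonym 'm tensor = "'m vfield list \<Rightarrow> 'm \<Rightarrow> real"

definition tuples ::
    "('m::topological_space, 'e::euclidean_space) atlas \<Rightarrow> nat \<Rightarrow> 'm vfield list set" where
  "tuples A k = {Xs. length Xs = k \<and> set Xs \<subseteq> vector_fields A}"

definition tensors ::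
    "('m::topological_space, 'e::euclidean_space) atlas \<Rightarrow> nat \<Rightarrow> 'm tensor set" where
  "tensors A k = {S. \<forall>Xs\<in>tuples A k. S Xs \<in> smooth_functions A \<and>
     (\<forall>i<k. \<forall>Y\<in>vector_fields A.
        (\<forall>Z\<in>vector_fields A. S (Xs[i := Y + Z]) = S (Xs[i := Y]) + S (Xs[i := Z])) \<and>
        (\<forall>\<psi>\<in>smooth_functions A. S (Xs[i := \<psi> \<odot> Y]) = \<psi> * S (Xs[i := Y])))}"

definition forms ::
    "('m::topological_space, 'e::euclidean_space) atlas \<Rightarrow> nat \<Rightarrow> 'm tensor set" where
  "forms A k = {\<omega>\<in>tensors A k.
     \<forall>Xs\<in>tuples A k. \<forall>i j. i < j \<and> j < k \<and> Xs ! i = Xs ! j \<longrightarrow> \<omega> Xs = 0}"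

definition endomorphisms ::
    "('m::topological_space, 'e::euclidean_space) atlas \<Rightarrow> ('m vfield \<Rightarrow> 'm vfield) set" where
  "endomorphisms A = {f. \<forall>X\<in>vector_fields A. f X \<in> vector_fields A \<and>
     (\<forall>Y\<in>vector_fields A. f (X + Y) = f X + f Y) \<and>
     (\<forall>\<psi>\<in>smooth_functions A. f (\<psi> \<odot> X) = \<psi> \<odot> f X)}"

text \<open>The value of \<open>X\<close> at \<open>p\<close> is the functional \<open>\<lambda>\<psi>. X \<psi> p\<close>.\<close>

definition riemannian_metric ::
    "('m::topological_space, 'e::euclidean_space) atlas \<Rightarrow> 'm tensor \<Rightarrow> bool" where
  "riemannian_metric A g \<longleftrightarrow> g \<in> tensors A 2 \<and>
     (\<forall>X\<in>vector_fields A. \<forall>Y\<in>vector_fields A. g [X, Y] = g [Y, X]) \<and>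
     (\<forall>X\<in>vector_fields A. \<forall>p. (\<exists>\<psi>\<in>smooth_functions A. X \<psi> p \<noteq> 0) \<longrightarrow> g [X, X] p > 0)"

text \<open>Local orthonormal frames near a point are represented by globally defined vector fields
  that are orthonormal on a neighbourhood of the point. Multiplying by a cut-off function shows
  that every local orthonormal frame coincides near the point with one of these.\<close>

definition orthonormal_frame_near ::
    "('m::topological_space, 'e::euclidean_space) atlas \<Rightarrow> 'm tensor \<Rightarrow> 'm
      \<Rightarrow> (nat \<Rightarrow> 'm vfield) \<Rightarrow> bool" where
  "orthonormal_frame_near A g p e \<longleftrightarrow>
     (\<forall>i<DIM('e). e i \<in> vector_fields A) \<and>
     (\<exists>U. open U \<and> p \<in> U \<and>
        (\<forall>q\<in>U. \<forall>i<DIM('e). \<forall>j<DIM('e). g [e i, e j] q = (if i = j then 1 else 0)))"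

text \<open>The traces below do not depend on the choice of the frame.\<close>

definition frame ::
    "('m::topological_space, 'e::euclidean_space) atlas \<Rightarrow> 'm tensor \<Rightarrow> 'm
      \<Rightarrow> nat \<Rightarrow> 'm vfield" where
  "frame A g p = (SOME e. orthonormal_frame_near A g p e)"


section \<open>Linear connections\<close>

type_synonym 'm connection = "'m vfield \<Rightarrow> 'm vfield \<Rightarrow> 'm vfield"

definition linear_connection ::
    "('m::topological_space, 'e::euclidean_space) atlas \<Rightarrow> 'm connection \<Rightarrow> bool" where
  "linear_connection A D \<longleftrightarrow>
     (\<forall>X\<in>vector_fields A. \<forall>Y\<in>vector_fields A. D X Y \<in> vector_fields A \<and>
        (\<forall>Z\<in>vector_fields A. D (X + Y) Z = D X Z + D Y Z \<and> D X (Y + Z) = D X Y + D X Z) \<and>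
        (\<forall>\<psi>\<in>smooth_functions A.
           D (\<psi> \<odot> X) Y = \<psi> \<odot> D X Y \<and> D X (\<psi> \<odot> Y) = X \<psi> \<odot> Y + \<psi> \<odot> D X Y))"

definition torsion :: "'m connection \<Rightarrow> 'm connection" where
  "torsion D X Y = D X Y - D Y X - lie_bracket X Y"

text \<open>The covariant derivative of a tensor along \<open>Y\<close>, for an operator \<open>D\<close> that acts
  on functions by \<open>\<psi> \<mapsto> (a Y) \<psi>\<close>: the map \<open>a\<close> is \<open>id\<close> for a linear connection and
  \<open>f\<close> for an \<open>f\<close>-connection.\<close>

definition cov ::
    "('m vfield \<Rightarrow> 'm vfield) \<Rightarrow> 'm connection \<Rightarrow> 'm vfield \<Rightarrow> 'm tensor \<Rightarrow> 'm tensor" where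
  "cov a D Y S Xs = (a Y) (S Xs) - (\<Sum>i<length Xs. S (Xs[i := D Y (Xs ! i)]))"

definition total_cov ::
    "('m vfield \<Rightarrow> 'm vfield) \<Rightarrow> 'm connection \<Rightarrow> 'm tensor \<Rightarrow> 'm tensor" where
  "total_cov a D S Zs = cov a D (hd Zs) S (tl Zs)"

definition metric_connection ::
    "('m::topological_space, 'e::euclidean_space) atlas \<Rightarrow> 'm tensor \<Rightarrow> 'm connection \<Rightarrow> bool" where
  "metric_connection A g D \<longleftrightarrow>
     (\<forall>X\<in>vector_fields A. \<forall>Y\<in>vector_fields A. \<forall>Z\<in>vector_fields A. cov id D X g [Y, Z] = 0)"

definition levi_civita ::
    "('m::topological_space, 'e::euclidean_space) atlas \<Rightarrow> 'm tensor \<Rightarrow> 'm connection \<Rightarrow> bool" where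
  "levi_civita A g D \<longleftrightarrow> linear_connection A D \<and> metric_connection A g D \<and>
     (\<forall>X\<in>vector_fields A. \<forall>Y\<in>vector_fields A. torsion D X Y = 0)"

definition einstein_connection ::
    "('m::topological_space, 'e::euclidean_space) atlas \<Rightarrow> 'm tensor \<Rightarrow> 'm connection \<Rightarrow> bool" where
  "einstein_connection A G D \<longleftrightarrow> linear_connection A D \<and>
     (\<forall>X\<in>vector_fields A. \<forall>Y\<in>vector_fields A. \<forall>Z\<in>vector_fields A.
        cov id D X G [Y, Z] = - G [torsion D X Y, Z])"


section \<open>\<open>f\<close>-connections\<close>

definition difference :: "'m connection \<Rightarrow> 'm connection \<Rightarrow> 'm connection" where
  "difference Dg D X Y = D X Y - Dg X Y"

definition metric_adjoint ::
    "('m::topological_space, 'e::euclidean_space) atlas \<Rightarrow> 'm tensor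
      \<Rightarrow> ('m vfield \<Rightarrow> 'm vfield) \<Rightarrow> 'm vfield \<Rightarrow> 'm vfield" where
  "metric_adjoint A g L Y =
     (THE W. W \<in> vector_fields A \<and> (\<forall>Z\<in>vector_fields A. g [W, Z] = g [Y, L Z]))"

definition f_connection ::
    "('m vfield \<Rightarrow> 'm vfield) \<Rightarrow> 'm connection \<Rightarrow> 'm connection \<Rightarrow> 'm connection" where
  "f_connection f Dg D X Y = Dg (f X) Y + difference Dg D X Y"

definition dual_f_connection ::
    "('m::topological_space, 'e::euclidean_space) atlas \<Rightarrow> 'm tensor
      \<Rightarrow> ('m vfield \<Rightarrow> 'm vfield) \<Rightarrow> 'm connection \<Rightarrow> 'm connection \<Rightarrow> 'm connection" where
  "dual_f_connection A g f Dg D X Y = Dg (f X) Y - metric_adjoint A g (difference Dg D X) Y"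

text \<open>In the following, \<open>N\<close> stands for the \<open>f\<close>-connection and \<open>N'\<close> for its
  dual.\<close>

definition adjoint_cov ::
    "('m::topological_space, 'e::euclidean_space) atlas \<Rightarrow> 'm tensor
      \<Rightarrow> ('m vfield \<Rightarrow> 'm vfield) \<Rightarrow> 'm connection \<Rightarrow> 'm tensor \<Rightarrow> 'm tensor" where
  "adjoint_cov A g f N' S Xs =
     (\<lambda>p. - (\<Sum>i<DIM('e). cov f N' (frame A g p i) S (frame A g p i # Xs) p))"

definition codifferential ::
    "('m::topological_space, 'e::euclidean_space) atlas \<Rightarrow> 'm tensor
      \<Rightarrow> ('m vfield \<Rightarrow> 'm vfield) \<Rightarrow> 'm connection \<Rightarrow> nat \<Rightarrow> 'm tensor \<Rightarrow> 'm tensor" where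
  "codifferential A g f N' k \<omega> = (if k = 0 then 0 else adjoint_cov A g f N' \<omega>)"

definition ext_f_derivative ::
    "('m vfield \<Rightarrow> 'm vfield) \<Rightarrow> 'm connection \<Rightarrow> 'm tensor \<Rightarrow> 'm tensor" where
  "ext_f_derivative f N \<omega> Xs =
     (\<Sum>i<length Xs. (- 1) ^ i * total_cov f N \<omega> (Xs ! i # take i Xs @ drop (Suc i) Xs))"

definition hodge_f_laplacian ::
    "('m::topological_space, 'e::euclidean_space) atlas \<Rightarrow> 'm tensor
      \<Rightarrow> ('m vfield \<Rightarrow> 'm vfield) \<Rightarrow> 'm connection \<Rightarrow> 'm connection
      \<Rightarrow> nat \<Rightarrow> 'm tensor \<Rightarrow> 'm tensor" where
  "hodge_f_laplacian A g f N N' k \<omega> =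
     ext_f_derivative f N (codifferential A g f N' k \<omega>)
     + codifferential A g f N' (Suc k) (ext_f_derivative f N \<omega>)"

definition second_cov ::
    "('m vfield \<Rightarrow> 'm vfield) \<Rightarrow> 'm connection \<Rightarrow> 'm vfield \<Rightarrow> 'm vfield
      \<Rightarrow> 'm tensor \<Rightarrow> 'm tensor" where
  "second_cov f N X Y S = cov f N X (cov f N Y S) - cov f N (N X Y) S"

definition f_curvature ::
    "('m vfield \<Rightarrow> 'm vfield) \<Rightarrow> 'm connection \<Rightarrow> 'm vfield \<Rightarrow> 'm vfield
      \<Rightarrow> 'm tensor \<Rightarrow> 'm tensor" where
  "f_curvature f N X Y S = second_cov f N X Y S - second_cov f N Y X S"

definition weitzenboeck ::
    "('m::topological_space, 'e::euclidean_space) atlas \<Rightarrow> 'm tensor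
      \<Rightarrow> ('m vfield \<Rightarrow> 'm vfield) \<Rightarrow> 'm connection \<Rightarrow> 'm tensor \<Rightarrow> 'm tensor" where
  "weitzenboeck A g f N S Xs = (\<lambda>p. \<Sum>a<length Xs. \<Sum>i<DIM('e).
     f_curvature f N (frame A g p i) (Xs ! a) S (Xs[a := frame A g p i]) p)"

end

theory Submission
  imports Defs
begin

text \<open>Since both the given connection and the Levi-Civita connection are metric, the difference
  tensor is skew, so the \<open>f\<close>-connection coincides with its dual and is metric itself. Hence
  $\nabla^f$ commutes with metric traces and with alternation, and
  $(\nabla^f_Y(\nabla^f\omega))(Z,\cdot) = (\nabla^f)^2_{Y,Z}\omega$. So $\breve\delta^f d^f\omega$ is
  $\breve\nabla^{*f}\nabla^f\omega$ plus the traces of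
  $((\nabla^f)^2_{e_i,X_a}\omega)(\dots,e_i,\dots)$, and $d^f\breve\delta^f\omega$ is minus the traces of
  $((\nabla^f)^2_{X_a,e_i}\omega)(\dots,e_i,\dots)$; the difference is the curvature term.

  Differentiating a trace requires that it agrees near each point with the trace in one fixed
  orthonormal frame. This rests on the existence of such frames (coordinate fields with cut-offs,
  then Gram-Schmidt) and on their completeness: by Hadamard's lemma a derivation is determined at
  a point by its values on the coordinate functions.\<close>

section \<open>Calculus of smooth functions on open sets\<close>

text \<open>Vector fields are derivations of global functions and tensors act on global fields, so
  nothing is pointwise by definition. That \<open>X \<psi> q\<close> depends only on the germ of
  \<open>\<psi>\<close> at \<open>q\<close>, and \<open>S Xs q\<close> only on the values of the
  arguments at \<open>q\<close>, has to be won with cut-off functions, which is why the development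
  starts from the calculus of exp(-1/x). The second obstacle is that \<open>frame A g p\<close> is
  chosen separately for every \<open>p\<close>, so a trace is not visibly smooth. In the frame
  frozen at \<open>p\<close>, passing from the plain to the covariant derivative of a trace adds
  terms in which \<open>N X (e i)\<close> replaces \<open>e i\<close> in one slot. Inner products of
  the frame fields are constant near \<open>p\<close>, so \<open>N X\<close> has a skew matrix there
  and these terms cancel. What remains is algebra: \<open>ext_f_derivative\<close>,
  \<open>second_cov\<close> and \<open>f_curvature\<close> are all built from \<open>N\<close>
  itself, so neither a Lie bracket nor a torsion term of \<open>N\<close> appears when derivatives
  are interchanged.\<close>

lemma Ck_on_Suc_has_derivative:
  assumes "Ck_on (Suc k) h S" "open S" "x \<in> S"
  shows "(h has_derivative frechet_derivative h (at x)) (at x)"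
  using assms by (simp add: differentiable_on_eq_differentiable_at frechet_derivative_works)

text \<open>Openness makes \<open>frechet_derivative\<close> at a point of \<open>S\<close> depend
  only on the values on \<open>S\<close>, so the induction can pass from the functions to their
  derivatives.\<close>

lemma Ck_on_cong:
  "open S \<Longrightarrow> (\<And>x. x \<in> S \<Longrightarrow> h1 x = h2 x) \<Longrightarrow> Ck_on k h1 S \<Longrightarrow> Ck_on k h2 S"
proof (induction k arbitrary: h1 h2)
  case 0 then show ?case by (simp cong: continuous_on_cong)
next
  case (Suc k)
  have d: "(h2 has_derivative frechet_derivative h1 (at x)) (at x)" if "x \<in> S" for x
    using has_derivative_transform_within_open[OF Ck_on_Suc_has_derivative[OF Suc.prems(3,1) that]
        Suc.prems(1) that Suc.prems(2)] .
  then have "frechet_derivative h1 (at x) = frechet_derivative h2 (at x)" if "x \<in> S" for x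
    using frechet_derivative_at that by blast
  then have "Ck_on k (\<lambda>x. frechet_derivative h2 (at x) v) S" for v
    using Suc.prems(3) by (intro Suc.IH[OF Suc.prems(1), of "\<lambda>x. frechet_derivative h1 (at x) v"
        "\<lambda>x. frechet_derivative h2 (at x) v"]) auto
  moreover have "h2 differentiable_on S"
    unfolding differentiable_on_def differentiable_def using d has_derivative_at_withinI by blast
  ultimately show ?case by simp
qed

text \<open>Derivatives are unique on an open set, so any explicit family \<open>h'\<close> may
  stand for the choice term \<open>frechet_derivative\<close>; the closure proofs below then need
  only the differentiation rules.\<close>

lemma Ck_on_SucI:
  assumes S: "open S" and h: "\<And>x. x \<in> S \<Longrightarrow> (h has_derivative h' x) (at x)"
    and h': "\<And>v. Ck_on k (\<lambda>x. h' x v) S"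
  shows "Ck_on (Suc k) h S"
proof -
  have eq: "h' x = frechet_derivative h (at x)" if "x \<in> S" for x
    using frechet_derivative_at[OF h[OF that]] .
  have "h differentiable_on S"
    unfolding differentiable_on_def differentiable_def
    using h has_derivative_at_withinI by blast
  moreover have "Ck_on k (\<lambda>x. frechet_derivative h (at x) v) S" for v
    by (rule Ck_on_cong[OF S _ h'[of v]]) (simp add: eq)
  ultimately show ?thesis by simp
qed

lemma Ck_on_subset: "Ck_on k h S \<Longrightarrow> T \<subseteq> S \<Longrightarrow> Ck_on k h T"
  by (induction k arbitrary: h) (auto intro: continuous_on_subset differentiable_on_subset)

lemma Ck_on_downgrade: "Ck_on (Suc k) h S \<Longrightarrow> Ck_on k h S"
  by (induction k arbitrary: h) (auto intro: differentiable_imp_continuous_on)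

lemma Ck_on_Union:
  "(\<And>T. T \<in> \<T> \<Longrightarrow> open T \<and> Ck_on k h T) \<Longrightarrow> Ck_on k h (\<Union>\<T>)"
proof (induction k arbitrary: h)
  case 0
  then have "continuous_on (\<Union>T\<in>\<T>. T) h"
    by (intro continuous_on_open_UN) auto
  then show ?case by simp
next
  case (Suc k)
  have "h differentiable (at x)" if "T \<in> \<T>" "x \<in> T" for x T
    using Suc.prems[OF that(1)] that by (auto simp: differentiable_on_eq_differentiable_at)
  then have "h differentiable_on (\<Union>\<T>)"
    unfolding differentiable_on_def by (blast intro: differentiable_at_withinI)
  then show ?case using Suc by simp
qed

lemma Ck_on_const: "Ck_on k (\<lambda>_. c) S"
  by (induction k arbitrary: c) (auto simp: differentiable_on_def)

lemma Ck_on_add: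
  "open S \<Longrightarrow> Ck_on k h1 S \<Longrightarrow> Ck_on k h2 S \<Longrightarrow> Ck_on k (\<lambda>x. h1 x + h2 x) S"
proof (induction k arbitrary: h1 h2)
  case 0 then show ?case by (auto intro: continuous_intros)
next
  case (Suc k)
  show ?case
  proof (rule Ck_on_SucI[OF Suc.prems(1)])
    show "((\<lambda>x. h1 x + h2 x) has_derivative
        (\<lambda>v. frechet_derivative h1 (at x) v + frechet_derivative h2 (at x) v)) (at x)" if "x \<in> S" for x
      using Ck_on_Suc_has_derivative Suc.prems that by (intro has_derivative_add) blast+
  qed (use Suc in auto)
qed

lemma Ck_on_mult:
  fixes h1 h2 :: "'a::euclidean_space \<Rightarrow> real"
  shows "open S \<Longrightarrow> Ck_on k h1 S \<Longrightarrow> Ck_on k h2 S \<Longrightarrow> Ck_on k (\<lambda>x. h1 x * h2 x) S"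
proof (induction k arbitrary: h1 h2)
  case 0 then show ?case by (auto intro: continuous_intros)
next
  case (Suc k)
  show ?case
  proof (rule Ck_on_SucI[OF Suc.prems(1)])
    show "((\<lambda>x. h1 x * h2 x) has_derivative
        (\<lambda>v. h1 x * frechet_derivative h2 (at x) v + frechet_derivative h1 (at x) v * h2 x)) (at x)" if "x \<in> S" for x
      using Ck_on_Suc_has_derivative Suc.prems that by (intro has_derivative_mult) blast+
    show "Ck_on k (\<lambda>x. h1 x * frechet_derivative h2 (at x) v + frechet_derivative h1 (at x) v * h2 x) S" for v
      using Suc.prems by (intro Ck_on_add Suc.IH) (auto intro: Ck_on_downgrade)
  qed
qed

lemma Ck_on_bounded_linear:
  assumes L: "bounded_linear L"
  shows "open S \<Longrightarrow> Ck_on k h S \<Longrightarrow> Ck_on k (\<lambda>x. L (h x)) S"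
proof (induction k arbitrary: h)
  case 0 then show ?case using L by (auto intro: bounded_linear.continuous_on)
next
  case (Suc k)
  show ?case
  proof (rule Ck_on_SucI[OF Suc.prems(1)])
    show "((\<lambda>x. L (h x)) has_derivative (\<lambda>v. L (frechet_derivative h (at x) v))) (at x)" if "x \<in> S" for x
      using Ck_on_Suc_has_derivative Suc.prems that by (intro bounded_linear.has_derivative[OF L]) blast+
  qed (use Suc in auto)
qed

lemma Ck_on_sum:
  "open S \<Longrightarrow> (\<And>i. i \<in> I \<Longrightarrow> Ck_on k (h i) S) \<Longrightarrow> Ck_on k (\<lambda>x. \<Sum>i\<in>I. h i x) S"
  by (induction I rule: infinite_finite_induct) (auto intro: Ck_on_const Ck_on_add)

lemma Ck_on_compose:
  fixes h :: "'b::euclidean_space \<Rightarrow> real" and u :: "'a::euclidean_space \<Rightarrow> 'b"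
  shows "open S \<Longrightarrow> open T \<Longrightarrow> u ` S \<subseteq> T \<Longrightarrow> Ck_on k h T \<Longrightarrow> Ck_on k u S \<Longrightarrow> Ck_on k (\<lambda>x. h (u x)) S"
proof (induction k arbitrary: h)
  case 0 then show ?case by (auto intro: continuous_on_compose2)
next
  case (Suc k)
  note prems = Suc.prems
  have dh: "(h has_derivative frechet_derivative h (at (u x))) (at (u x))" if "x \<in> S" for x
    using Ck_on_Suc_has_derivative[OF prems(4,2)] prems(3) that by blast
  have lin: "linear (frechet_derivative h (at (u x)))" if "x \<in> S" for x
    using dh[OF that] has_derivative_linear by blast
  \<comment> \<open>In the chain rule both the base point and the direction depend on
    \<open>x\<close>. Expanding the direction in the basis leaves products of a component of the
    derivative of \<open>u\<close> with a partial derivative of \<open>h\<close> along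
    \<open>u\<close>, and the induction hypothesis covers the latter.\<close>
  have eq: "frechet_derivative h (at (u x)) w
      = (\<Sum>b\<in>Basis. (w \<bullet> b) * frechet_derivative h (at (u x)) b)" if "x \<in> S" for x w
    by (subst euclidean_representation[of w, symmetric])
      (simp add: linear_sum[OF lin[OF that]] linear_scale[OF lin[OF that]])
  show ?case
  proof (rule Ck_on_SucI[OF prems(1)])
    show "((\<lambda>x. h (u x)) has_derivative
        (\<lambda>v. \<Sum>b\<in>Basis. (frechet_derivative u (at x) v \<bullet> b) * frechet_derivative h (at (u x)) b)) (at x)"
      if "x \<in> S" for x
      by (rule has_derivative_eq_rhs[OF has_derivative_compose[OF
            Ck_on_Suc_has_derivative[OF prems(5,1) that] dh[OF that]]]) (rule ext, rule eq[OF that])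
    show "Ck_on k (\<lambda>x. \<Sum>b\<in>Basis. (frechet_derivative u (at x) v \<bullet> b) * frechet_derivative h (at (u x)) b) S" for v
    proof (intro Ck_on_sum Ck_on_mult prems(1))
      show "Ck_on k (\<lambda>x. frechet_derivative u (at x) v \<bullet> b) S" for b
        using prems by (intro Ck_on_bounded_linear[OF bounded_linear_inner_left]) auto
      show "Ck_on k (\<lambda>x. frechet_derivative h (at (u x)) b) S" for b
        using prems by (intro Suc.IH[where h = "\<lambda>y. frechet_derivative h (at y) b"]) (auto intro: Ck_on_downgrade)
    qed
  qed
qed

lemma Ck_on_id: "open S \<Longrightarrow> Ck_on k (\<lambda>x. x) S"
proof (cases k)
  case (Suc j)
  assume "open S"
  then show ?thesis unfolding Suc
    by (intro Ck_on_SucI[where h' = "\<lambda>_ v. v"]) (auto intro: Ck_on_const)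
qed auto

lemma smooth_on_cong: "open S \<Longrightarrow> (\<And>x. x \<in> S \<Longrightarrow> h1 x = h2 x) \<Longrightarrow> smooth_on h1 S \<Longrightarrow> smooth_on h2 S"
  unfolding smooth_on_def using Ck_on_cong by blast

lemma smooth_on_subset: "smooth_on h S \<Longrightarrow> T \<subseteq> S \<Longrightarrow> smooth_on h T"
  unfolding smooth_on_def using Ck_on_subset by blast

lemma smooth_on_Union: "(\<And>T. T \<in> \<T> \<Longrightarrow> open T \<and> smooth_on h T) \<Longrightarrow> smooth_on h (\<Union>\<T>)"
  unfolding smooth_on_def using Ck_on_Union by blast

lemma smooth_on_const: "smooth_on (\<lambda>_. c) S"
  unfolding smooth_on_def by (simp add: Ck_on_const)

lemma smooth_on_id: "open S \<Longrightarrow> smooth_on (\<lambda>x. x) S"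
  unfolding smooth_on_def by (simp add: Ck_on_id)

lemma smooth_on_add:
  "open S \<Longrightarrow> smooth_on h1 S \<Longrightarrow> smooth_on h2 S \<Longrightarrow> smooth_on (\<lambda>x. h1 x + h2 x) S"
  unfolding smooth_on_def by (simp add: Ck_on_add)

lemma smooth_on_sum:
  "open S \<Longrightarrow> (\<And>i. i \<in> I \<Longrightarrow> smooth_on (h i) S) \<Longrightarrow> smooth_on (\<lambda>x. \<Sum>i\<in>I. h i x) S"
  unfolding smooth_on_def by (simp add: Ck_on_sum)

lemma smooth_on_mult:
  fixes h1 h2 :: "'a::euclidean_space \<Rightarrow> real"
  shows "open S \<Longrightarrow> smooth_on h1 S \<Longrightarrow> smooth_on h2 S \<Longrightarrow> smooth_on (\<lambda>x. h1 x * h2 x) S"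
  unfolding smooth_on_def by (simp add: Ck_on_mult)

lemma smooth_on_bounded_linear:
  "bounded_linear L \<Longrightarrow> open S \<Longrightarrow> smooth_on h S \<Longrightarrow> smooth_on (\<lambda>x. L (h x)) S"
  unfolding smooth_on_def by (simp add: Ck_on_bounded_linear)

lemma smooth_on_compose:
  fixes h :: "'b::euclidean_space \<Rightarrow> real" and u :: "'a::euclidean_space \<Rightarrow> 'b"
  shows "open S \<Longrightarrow> open T \<Longrightarrow> u ` S \<subseteq> T \<Longrightarrow> smooth_on h T \<Longrightarrow> smooth_on u S \<Longrightarrow> smooth_on (\<lambda>x. h (u x)) S"
  unfolding smooth_on_def using Ck_on_compose by blast

lemma smooth_on_continuous: "smooth_on h S \<Longrightarrow> continuous_on S h"
  unfolding smooth_on_def by (metis Ck_on.simps(1))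

lemma smooth_on_has_derivative:
  "smooth_on h S \<Longrightarrow> open S \<Longrightarrow> x \<in> S \<Longrightarrow> (h has_derivative frechet_derivative h (at x)) (at x)"
  unfolding smooth_on_def using Ck_on_Suc_has_derivative by blast

lemma smooth_on_derivative: "smooth_on h S \<Longrightarrow> smooth_on (\<lambda>x. frechet_derivative h (at x) v) S"
  unfolding smooth_on_def by (metis Ck_on.simps(2))

section \<open>Powers, flat functions and a smooth cut-off on the real line\<close>

lemma smooth_on_powr: "smooth_on (\<lambda>x::real. x powr r) {0<..}"
proof -
  \<comment> \<open>The factor \<open>c\<close> makes the family closed under differentiation, which
    multiplies by the exponent.\<close>
  have "Ck_on k (\<lambda>x. c * x powr r) {0<..}" for k and c r :: real
  proof (induction k arbitrary: c r)
    case 0 show ?case by (auto intro!: continuous_intros)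
  next
    case (Suc k)
    show ?case
    proof (rule Ck_on_SucI)
      show "((\<lambda>x. c * x powr r) has_derivative (\<lambda>v. v * (c * r) * x powr (r - 1))) (at x)" if "x \<in> {0<..}" for x
        using that by (auto intro!: derivative_eq_intros simp: powr_diff field_simps)
    qed (use Suc in auto)
  qed
  from this[of _ 1] show ?thesis by (simp add: smooth_on_def)
qed

text \<open>All derivatives of $e^{-1/x}$ are linear combinations of these functions.\<close>

definition exp_flat :: "nat \<Rightarrow> real \<Rightarrow> real" where
  "exp_flat n x = (if x > 0 then inverse x ^ n * exp (- inverse x) else 0)"

text \<open>The quadratic decay is what makes the difference quotient at 0 tend to 0.\<close>

lemma exp_flat_bound: "\<bar>exp_flat n x\<bar> \<le> fact (n + 2) * x\<^sup>2"
proof (cases "x > 0")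
  case True
  define y where "y = inverse x"
  have y: "y > 0" "x = inverse y" using True by (auto simp: y_def)
  \<comment> \<open>The single term of degree \<open>n + 2\<close> of the exponential series bounds
    \<open>exp y\<close> from below; the two surplus powers of \<open>y = 1/x\<close> become
    \<open>x\<^sup>2\<close>.\<close>
  have "y ^ (n + 2) /\<^sub>R fact (n + 2) \<le> exp y"
    unfolding exp_def using y summable_exp_generic[of y]
    by (intro order_trans[OF _ sum_le_suminf[of _ "{n+2}"]]) auto
  then have "y ^ (n + 2) \<le> fact (n + 2) * exp y"
    by (simp add: field_simps del: power_add fact_Suc)
  then have "y ^ n * exp (- y) \<le> fact (n + 2) * (inverse y)\<^sup>2"
    using y by (simp add: field_simps exp_minus power_add power2_eq_square del: fact_Suc)
  then show ?thesis using y True by (simp add: exp_flat_def y_def[symmetric] del: fact_Suc)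
qed (simp add: exp_flat_def)

text \<open>For positive \<open>x\<close> put \<open>y = 1/x\<close>, so that dy/dx is
  \<open>- y ^ 2\<close>: the product rule turns \<open>y ^ n * exp (- y)\<close> into
  \<open>y ^ (n + 2) * exp (- y) - n * y ^ (n + 1) * exp (- y)\<close>. At 0 the bound
  \<open>exp_flat_bound\<close> gives derivative 0.\<close>

lemma exp_flat_has_derivative:
  "(exp_flat n has_derivative (\<lambda>v. v * (exp_flat (n + 2) x + - real n * exp_flat (n + 1) x))) (at x)"
proof (cases x "0::real" rule: linorder_cases)
  case less
  have "((\<lambda>_. 0::real) has_derivative (\<lambda>v. 0)) (at x)" by simp
  then have "(exp_flat n has_derivative (\<lambda>v. 0)) (at x)"
    by (rule has_derivative_transform_within_open[of _ _ _ _ "{..<0}"]) (use less in \<open>auto simp: exp_flat_def\<close>)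
  then show ?thesis using less by (simp add: exp_flat_def)
next
  case equal
  have "((\<lambda>h. exp_flat n h / h) \<longlongrightarrow> 0) (at 0)"
  proof (rule Lim_null_comparison)
    show "\<forall>\<^sub>F h in at 0. norm (exp_flat n h / h) \<le> fact (n + 2) * \<bar>h\<bar>"
    proof (intro always_eventually allI)
      fix h :: real
      show "norm (exp_flat n h / h) \<le> fact (n + 2) * \<bar>h\<bar>"
        using exp_flat_bound[of n h]
        by (cases "h = 0") (auto simp: field_simps power2_eq_square simp del: fact_Suc)
    qed
    show "((\<lambda>h. fact (n + 2) * \<bar>h\<bar>) \<longlongrightarrow> (0::real)) (at 0)"
      by (auto intro!: tendsto_eq_intros)
  qed
  then have "(exp_flat n has_field_derivative 0) (at 0)"
    by (simp add: has_field_derivative_iff exp_flat_def)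
  then have "(exp_flat n has_derivative (\<lambda>v. 0)) (at 0)"
    by (rule has_derivative_eq_rhs[OF has_field_derivative_imp_has_derivative]) auto
  then show ?thesis using equal by (simp add: exp_flat_def)
next
  case greater
  define w where "w = inverse x"
  have "((\<lambda>w. w ^ n * exp (- w)) has_field_derivative
      (real n * w ^ (n - 1) * exp (- w) - w ^ n * exp (- w))) (at w)"
    by (auto intro!: derivative_eq_intros)
  moreover have "(inverse has_field_derivative - (w * w)) (at x)"
    using greater by (auto intro!: derivative_eq_intros simp: w_def)
  ultimately have "((\<lambda>y. inverse y ^ n * exp (- inverse y)) has_field_derivative
      (real n * w ^ (n - 1) * exp (- w) - w ^ n * exp (- w)) * - (w * w)) (at x)"
    unfolding w_def by (rule DERIV_chain2)
  moreover have "(real n * w ^ (n - 1) * exp (- w) - w ^ n * exp (- w)) * - (w * w)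
      = exp_flat (n + 2) x + - real n * exp_flat (n + 1) x"
    using greater by (cases n) (simp_all add: exp_flat_def w_def[symmetric] algebra_simps)
  ultimately have "((\<lambda>y. inverse y ^ n * exp (- inverse y)) has_field_derivative
      (exp_flat (n + 2) x + - real n * exp_flat (n + 1) x)) (at x)" by simp
  then have "((\<lambda>y. inverse y ^ n * exp (- inverse y)) has_derivative
      (\<lambda>v. v * (exp_flat (n + 2) x + - real n * exp_flat (n + 1) x))) (at x)"
    by (rule has_derivative_eq_rhs[OF has_field_derivative_imp_has_derivative]) auto
  then show ?thesis
    by (rule has_derivative_transform_within_open[of _ _ _ _ "{0<..}"]) (use greater in \<open>auto simp: exp_flat_def\<close>)
qed

lemma smooth_on_exp_flat: "smooth_on (exp_flat n) UNIV"
proof -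
  have "Ck_on k (exp_flat n) UNIV" for k
  proof (induction k arbitrary: n)
    case 0
    show ?case using exp_flat_has_derivative[of n]
      by (auto intro!: continuous_at_imp_continuous_on has_derivative_continuous)
  next
    case (Suc k)
    show ?case
      by (rule Ck_on_SucI[OF _ exp_flat_has_derivative]) (intro Ck_on_mult Ck_on_add Ck_on_const Suc open_UNIV)+
  qed
  then show ?thesis by (simp add: smooth_on_def)
qed

lemma smooth_cutoff:
  obtains h :: "real \<Rightarrow> real" where "smooth_on h UNIV" "\<forall>t\<le>1. h t = 1" "\<forall>t\<ge>2. h t = 0"
proof -
  \<comment> \<open>The cut-off is the first summand divided by \<open>d\<close>. As
    \<open>2 - t\<close> and \<open>t - 1\<close> add up to 1, one of them is positive and
    \<open>d\<close> never vanishes. The reciprocal is written with \<open>powr\<close> to reuse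
    \<open>smooth_on_powr\<close>.\<close>
  define d where "d t = exp_flat 0 (2 - t) + exp_flat 0 (t - 1)" for t
  have nonneg: "exp_flat 0 t \<ge> 0" for t by (simp add: exp_flat_def)
  have pos: "exp_flat 0 t > 0" if "t > 0" for t using that by (simp add: exp_flat_def)
  have d: "d t > 0" for t
    unfolding d_def using nonneg[of "2-t"] nonneg[of "t-1"] pos[of "2-t"] pos[of "t-1"]
    by (cases "t < 2") (auto intro: add_pos_nonneg add_nonneg_pos)
  have aff: "smooth_on (\<lambda>t::real. a * t + b) UNIV" for a b
    by (intro smooth_on_add smooth_on_mult smooth_on_const smooth_on_id) auto
  have s1: "smooth_on (\<lambda>t. exp_flat 0 (2 - t)) UNIV"
    using smooth_on_compose[OF _ _ _ smooth_on_exp_flat aff[of "-1" 2]] by (simp add: algebra_simps)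
  have s2: "smooth_on (\<lambda>t. exp_flat 0 (t - 1)) UNIV"
    using smooth_on_compose[OF _ _ _ smooth_on_exp_flat aff[of "1" "-1"]] by (simp add: algebra_simps)
  have s3: "smooth_on d UNIV" unfolding d_def using s1 s2 by (intro smooth_on_add) auto
  have "smooth_on (\<lambda>t. (d t) powr (-1)) UNIV"
    by (rule smooth_on_compose[OF _ _ _ smooth_on_powr s3]) (use d in auto)
  then have s4: "smooth_on (\<lambda>t. exp_flat 0 (2 - t) * (d t) powr (-1)) UNIV"
    using s1 by (intro smooth_on_mult) auto
  show ?thesis
  proof (rule that[OF s4])
    show "\<forall>t\<le>1. exp_flat 0 (2 - t) * d t powr -1 = 1"
      by (simp add: d_def exp_flat_def powr_minus)
  qed (simp add: exp_flat_def)
qed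

text \<open>The weight \<open>t ^ j\<close> makes the family of these integrals closed under differentiation: each
  derivative in \<open>x\<close> produces a further factor \<open>t\<close>.\<close>

lemma Ck_on_integral:
  fixes h :: "'a::euclidean_space \<Rightarrow> real"
  assumes S: "open S" "convex S" "a \<in> S"
  shows "Ck_on k h S \<Longrightarrow> Ck_on k (\<lambda>x. integral {0..1} (\<lambda>t. t ^ j * h (a + t *\<^sub>R (x - a)))) S"
proof -
  have mem: "a + t *\<^sub>R (x - a) \<in> S" if "x \<in> S" "t \<in> {0..1}" for x t
    using convexD_alt[OF S(2,3) that(1), of t] that(2) by (simp add: algebra_simps)
  have cont: "continuous_on (S \<times> cbox 0 1) (\<lambda>(x, t). t ^ j * h (a + t *\<^sub>R (x - a)))"
    if "continuous_on S h" for h :: "'a \<Rightarrow> real" and j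
    unfolding split_beta
    by (intro continuous_intros continuous_on_compose2[OF that]) (auto intro: mem)
  show "Ck_on k h S \<Longrightarrow> Ck_on k (\<lambda>x. integral {0..1} (\<lambda>t. t ^ j * h (a + t *\<^sub>R (x - a)))) S"
  proof (induction k arbitrary: h j)
    case 0
    then show ?case using integral_continuous_on_param[OF cont[of h j]] by simp
  next
    case (Suc k)
    have contd: "continuous_on S (\<lambda>y. frechet_derivative h (at y) v)" for v
    proof -
      have "Ck_on k (\<lambda>x. frechet_derivative h (at x) v) S" using Suc.prems by simp
      then show ?thesis by (cases k) (auto intro: differentiable_imp_continuous_on)
    qed
    have bl: "bounded_linear (frechet_derivative h (at y))" if "y \<in> S" for y
      using Ck_on_Suc_has_derivative[OF Suc.prems S(1) that] has_derivative_bounded_linear by blast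
    \<comment> \<open>The derivative of the integrand in \<open>x\<close>, with the extra factor
      \<open>t\<close> of the chain rule. It is packed into a bounded linear operator because
      \<open>leibniz_rule\<close> integrates operator-valued derivatives.\<close>
    define D where "D x t = Blinfun (\<lambda>v. t ^ Suc j * frechet_derivative h (at (a + t *\<^sub>R (x - a))) v)" for x t
    have D: "blinfun_apply (D x t) = (\<lambda>v. t ^ Suc j * frechet_derivative h (at (a + t *\<^sub>R (x - a))) v)"
      if "x \<in> S" "t \<in> {0..1}" for x t
      unfolding D_def
      by (intro bounded_linear_Blinfun_apply bounded_linear_const_mult bl mem that)
    \<comment> \<open>In finite dimension, continuity in the operator norm can be tested on basis
      vectors.\<close>
    have contD: "continuous_on (S \<times> cbox 0 1) (\<lambda>(x, t). D x t)"
    proof (rule continuous_on_blinfun_componentwise)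
      fix b :: 'a assume "b \<in> Basis"
      have "continuous_on (S \<times> cbox 0 1) (\<lambda>(x, t). t ^ Suc j * frechet_derivative h (at (a + t *\<^sub>R (x - a))) b)"
        by (rule cont[OF contd])
      then show "continuous_on (S \<times> cbox 0 1) (\<lambda>p. blinfun_apply (case p of (x, t) \<Rightarrow> D x t) b)"
        by (rule continuous_on_eq) (auto simp: D)
    qed
    have int: "(\<lambda>t. t ^ j * h (a + t *\<^sub>R (x - a))) integrable_on cbox 0 1" if "x \<in> S" for x
    proof -
      have "continuous_on S h" using Suc.prems by (auto intro: differentiable_imp_continuous_on)
      then have "continuous_on (cbox 0 1) (\<lambda>t. h (a + t *\<^sub>R (x - a)))"
        by (rule continuous_on_compose2) (auto intro!: continuous_intros mem that)
      then show ?thesis by (intro integrable_continuous continuous_intros)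
    qed
    have intD: "D x integrable_on cbox 0 1" if "x \<in> S" for x
    proof (intro integrable_continuous)
      have "continuous_on (cbox 0 1) (\<lambda>t. case (x, t) of (x, t) \<Rightarrow> D x t)"
        by (rule continuous_on_compose2[OF contD]) (use that in \<open>auto intro!: continuous_intros\<close>)
      then show "continuous_on (cbox 0 1) (D x)" by simp
    qed
    show ?case
    proof (rule Ck_on_SucI[OF S(1)])
      fix x assume x: "x \<in> S"
      have "((\<lambda>x. t ^ j * h (a + t *\<^sub>R (x - a))) has_derivative blinfun_apply (D x t)) (at x within S)"
        if "x \<in> S" "t \<in> cbox 0 1" for x t
      proof -
        have t: "t \<in> {0..1}" using that by simp
        have "linear (frechet_derivative h (at (a + t *\<^sub>R (x - a))))"
          using bl[OF mem[OF that(1) t]] by (simp add: bounded_linear.linear)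
        note lin = linear_scale[OF this]
        have "((\<lambda>x. a + t *\<^sub>R (x - a)) has_derivative (\<lambda>v. t *\<^sub>R v)) (at x)"
          by (auto intro!: derivative_eq_intros)
        from has_derivative_compose[OF this Ck_on_Suc_has_derivative[OF Suc.prems S(1) mem[OF that(1) t]]]
        have "((\<lambda>x. t ^ j * h (a + t *\<^sub>R (x - a))) has_derivative
            (\<lambda>v. t ^ j * frechet_derivative h (at (a + t *\<^sub>R (x - a))) (t *\<^sub>R v))) (at x)"
          by (rule has_derivative_mult_right)
        moreover have "(\<lambda>v. t ^ j * frechet_derivative h (at (a + t *\<^sub>R (x - a))) (t *\<^sub>R v))
            = blinfun_apply (D x t)"
          unfolding D[OF that(1) t] lin by (simp only: real_scaleR_def power_Suc ac_simps)
        ultimately show ?thesis by (simp only: has_derivative_at_withinI)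
      qed
      from leibniz_rule[OF this int contD x S(2)]
      have "((\<lambda>x. integral (cbox 0 1) (\<lambda>t. t ^ j * h (a + t *\<^sub>R (x - a)))) has_derivative
          blinfun_apply (integral (cbox 0 1) (D x))) (at x within S)" by simp
      then show "((\<lambda>x. integral {0..1} (\<lambda>t. t ^ j * h (a + t *\<^sub>R (x - a)))) has_derivative
          blinfun_apply (integral (cbox 0 1) (D x))) (at x)"
        using at_within_open[OF x S(1)] by simp
    next
      fix v
      have "Ck_on k (\<lambda>x. integral {0..1} (\<lambda>t. t ^ Suc j * frechet_derivative h (at (a + t *\<^sub>R (x - a))) v)) S"
        using Suc.prems by (intro Suc.IH) auto
      then show "Ck_on k (\<lambda>x. blinfun_apply (integral (cbox 0 1) (D x)) v) S"
      proof (rule Ck_on_cong[OF S(1), rotated])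
        fix x assume x: "x \<in> S"
        have "blinfun_apply (integral (cbox 0 1) (D x)) v = integral (cbox 0 1) (\<lambda>t. blinfun_apply (D x t) v)"
          by (rule blinfun_apply_integral[OF intD[OF x]])
        also have "\<dots> = integral {0..1} (\<lambda>t. t ^ Suc j * frechet_derivative h (at (a + t *\<^sub>R (x - a))) v)"
          using D[OF x] by (auto intro: integral_cong)
        finally show "integral {0..1} (\<lambda>t. t ^ Suc j * frechet_derivative h (at (a + t *\<^sub>R (x - a))) v) =
            blinfun_apply (integral (cbox 0 1) (D x)) v" by simp
      qed
    qed
  qed
qed

text \<open>Integrate the derivative of \<open>h\<close> along the segment from \<open>a\<close> to
  \<open>x\<close>, which convexity keeps inside \<open>S\<close>, and expand the direction
  \<open>x - a\<close> in the basis: \<open>G b\<close> is the mean of the \<open>b\<close>-th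
  partial derivative over the segment.\<close>

lemma hadamard:
  fixes h :: "'a::euclidean_space \<Rightarrow> real"
  assumes S: "open S" "convex S" "a \<in> S" and h: "smooth_on h S"
  obtains G where "\<And>b. smooth_on (G b) S" "\<And>b. G b a = frechet_derivative h (at a) b"
    "\<And>x. x \<in> S \<Longrightarrow> h x = h a + (\<Sum>b\<in>Basis. ((x - a) \<bullet> b) * G b x)"
proof -
  define G where "G b x = integral {0..1} (\<lambda>t. frechet_derivative h (at (a + t *\<^sub>R (x - a))) b)" for b x
  have mem: "a + t *\<^sub>R (x - a) \<in> S" if "x \<in> S" "t \<in> {0..1}" for x t
    using convexD_alt[OF S(2,3) that(1), of t] that(2) by (simp add: algebra_simps)
  show ?thesis
  proof (rule that)
    show "smooth_on (G b) S" for b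
    proof -
      have "smooth_on (\<lambda>y. frechet_derivative h (at y) b) S" by (rule smooth_on_derivative[OF h])
      then show ?thesis unfolding smooth_on_def G_def[abs_def] using Ck_on_integral[OF S, where j=0] by auto
    qed
    show "G b a = frechet_derivative h (at a) b" for b by (simp add: G_def)
    fix x assume x: "x \<in> S"
    let ?d = "\<lambda>t. frechet_derivative h (at (a + t *\<^sub>R (x - a)))"
    have lin: "linear (?d t)" if "t \<in> {0..1}" for t
      using smooth_on_has_derivative[OF h S(1) mem[OF x that]] has_derivative_linear by blast
    have "((\<lambda>t. h (a + t *\<^sub>R (x - a))) has_vector_derivative ?d t (x - a)) (at t within {0..1})"
      if t: "t \<in> {0..1}" for t
    proof -
      have "((\<lambda>t. a + t *\<^sub>R (x - a)) has_derivative (\<lambda>s. s *\<^sub>R (x - a))) (at t within {0..1})"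
        by (auto intro!: derivative_eq_intros)
      from has_derivative_compose[OF this smooth_on_has_derivative[OF h S(1) mem[OF x t]]]
      show ?thesis by (simp add: has_vector_derivative_def linear_scale[OF lin[OF t]])
    qed
    from fundamental_theorem_of_calculus[OF _ this]
    have 1: "((\<lambda>t. ?d t (x - a)) has_integral (h x - h a)) {0..1}" by simp
    have int: "(\<lambda>t. ?d t b) integrable_on {0..1}" for b
    proof (rule integrable_continuous_interval)
      show "continuous_on {0..1} (\<lambda>t. ?d t b)"
        by (rule continuous_on_compose2[OF smooth_on_continuous[OF smooth_on_derivative[OF h, of b]]])
          (auto intro!: continuous_intros mem x)
    qed
    have "((\<lambda>t. \<Sum>b\<in>Basis. ((x - a) \<bullet> b) * ?d t b) has_integral (\<Sum>b\<in>Basis. ((x - a) \<bullet> b) * G b x)) {0..1}"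
      unfolding G_def by (intro has_integral_sum has_integral_mult_right integrable_integral int) auto
    moreover have "(\<Sum>b\<in>Basis. ((x - a) \<bullet> b) * ?d t b) = ?d t (x - a)" if "t \<in> {0..1}" for t
    proof -
      have "?d t (x - a) = ?d t (\<Sum>b\<in>Basis. ((x - a) \<bullet> b) *\<^sub>R b)" by (simp add: euclidean_representation)
      then show ?thesis by (simp add: linear_sum[OF lin[OF that]] linear_scale[OF lin[OF that]])
    qed
    ultimately have "((\<lambda>t. ?d t (x - a)) has_integral (\<Sum>b\<in>Basis. ((x - a) \<bullet> b) * G b x)) {0..1}"
      by (subst has_integral_cong[of _ _ "\<lambda>t. \<Sum>b\<in>Basis. ((x - a) \<bullet> b) * ?d t b"]) auto
    from has_integral_unique[OF 1 this]
    show "h x = h a + (\<Sum>b\<in>Basis. ((x - a) \<bullet> b) * G b x)" by simp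
  qed
qed

section \<open>Smooth functions and derivations on a manifold\<close>

lemma sum_fun_apply [simp]: "(\<Sum>i\<in>I. h i) x = (\<Sum>i\<in>I. h i x)"
  by (induction I rule: infinite_finite_induct) auto

locale manifold =
  fixes A :: "('m::{t2_space,second_countable_topology}, 'e::euclidean_space) atlas"
  assumes smooth_manifold: "smooth_manifold A"
begin

abbreviation "C \<equiv> smooth_functions A"
abbreviation "V \<equiv> vector_fields A"

text \<open>For open \<open>W\<close> this is smoothness of the restriction to \<open>W\<close>; the values of \<open>\<psi>\<close> outside \<open>W\<close>
  do not matter.\<close>

definition sm_on :: "'m set \<Rightarrow> ('m \<Rightarrow> real) \<Rightarrow> bool" where
  "sm_on W \<psi> \<longleftrightarrow> (\<forall>(U, \<phi>)\<in>A. smooth_on (\<lambda>y. \<psi> (inv_into U \<phi> y)) (\<phi> ` (U \<inter> W)))"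

lemma smooth_functions_iff: "\<psi> \<in> C \<longleftrightarrow> sm_on UNIV \<psi>"
  by (simp add: smooth_functions_def sm_on_def o_def)

lemma chart_at:
  obtains U \<phi> where "(U, \<phi>) \<in> A" "p \<in> U"
proof -
  have "p \<in> (\<Union>(U, \<phi>)\<in>A. U)" using smooth_manifold[unfolded smooth_manifold_def, THEN conjunct1] by simp
  then show ?thesis using that by auto
qed

context
  fixes U \<phi> assumes chart: "(U, \<phi>) \<in> A"
begin

lemma chart_open: "open U" and chart_open_image: "open (\<phi> ` U)"
  and chart_homeomorphism: "homeomorphism U (\<phi> ` U) \<phi> (inv_into U \<phi>)"
  using smooth_manifold[unfolded smooth_manifold_def, THEN conjunct2, THEN conjunct1, THEN bspec, OF chart]
  by simp_all

lemma chart_inv [simp]: "q \<in> U \<Longrightarrow> inv_into U \<phi> (\<phi> q) = q"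
  using chart_homeomorphism by (simp add: homeomorphism_def)

lemma chart_continuous: "continuous_on U \<phi>"
  and chart_inv_continuous: "continuous_on (\<phi> ` U) (inv_into U \<phi>)"
  using chart_homeomorphism by (auto simp: homeomorphism_def)

lemma chart_image_open:
  assumes "open W" shows "open (\<phi> ` (U \<inter> W))"
  by (rule openin_open_trans[OF homeomorphism_imp_open_map[OF chart_homeomorphism
        openin_open_Int[OF assms]] chart_open_image])

lemma chart_preimage_open: "open B \<Longrightarrow> open (U \<inter> \<phi> -` B)"
  using continuous_open_preimage[OF chart_continuous chart_open] .

lemma chart_transition:
  "(V', \<kappa>) \<in> A \<Longrightarrow> smooth_on (\<lambda>y. \<phi> (inv_into V' \<kappa> y)) (\<kappa> ` (V' \<inter> U))"
proof -
  assume "(V', \<kappa>) \<in> A"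
  from smooth_manifold[unfolded smooth_manifold_def, THEN conjunct2, THEN conjunct2, THEN bspec, OF this]
  have "\<forall>(U, \<phi>)\<in>A. smooth_on (\<phi> \<circ> inv_into V' \<kappa>) (\<kappa> ` (V' \<inter> U))" by simp
  from bspec[OF this chart] show ?thesis by (simp add: o_def)
qed

end

lemma sm_on_chartD:
  "sm_on W \<psi> \<Longrightarrow> (U, \<phi>) \<in> A \<Longrightarrow> smooth_on (\<lambda>y. \<psi> (inv_into U \<phi> y)) (\<phi> ` (U \<inter> W))"
  unfolding sm_on_def by blast

text \<open>The smooth transition maps carry smoothness from this one chart to all the
  others.\<close>

lemma sm_on_chartI:
  assumes c: "(U, \<phi>) \<in> A" and W: "open W" "W \<subseteq> U" and u: "smooth_on u (\<phi> ` W)"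
  shows "sm_on W (\<lambda>q. u (\<phi> q))"
  unfolding sm_on_def
proof clarify
  fix U' \<kappa> assume d: "(U', \<kappa>) \<in> A"
  have "open (\<phi> ` W)" using chart_image_open[OF c W(1)] W(2) by (simp add: Int_absorb1)
  moreover have "smooth_on (\<lambda>y. \<phi> (inv_into U' \<kappa> y)) (\<kappa> ` (U' \<inter> W))"
    by (rule smooth_on_subset[OF chart_transition[OF c d]]) (use W(2) in auto)
  moreover have "(\<lambda>y. \<phi> (inv_into U' \<kappa> y)) ` \<kappa> ` (U' \<inter> W) \<subseteq> \<phi> ` W"
    using chart_inv[OF d] by auto
  ultimately show "smooth_on (\<lambda>y. u (\<phi> (inv_into U' \<kappa> y))) (\<kappa> ` (U' \<inter> W))"
    by (intro smooth_on_compose[OF chart_image_open[OF d W(1)] _ _ u])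
qed

lemma sm_on_cong:
  assumes W: "open W" and eq: "\<And>q. q \<in> W \<Longrightarrow> \<psi> q = \<xi> q" and s: "sm_on W \<psi>"
  shows "sm_on W \<xi>"
  unfolding sm_on_def
proof clarify
  fix U \<phi> assume c: "(U, \<phi>) \<in> A"
  show "smooth_on (\<lambda>y. \<xi> (inv_into U \<phi> y)) (\<phi> ` (U \<inter> W))"
    by (rule smooth_on_cong[OF chart_image_open[OF c W] _ sm_on_chartD[OF s c]])
      (use eq chart_inv[OF c] in auto)
qed

lemma sm_on_subset:
  assumes "sm_on W \<psi>" "W' \<subseteq> W" shows "sm_on W' \<psi>"
  unfolding sm_on_def
proof clarify
  fix U \<phi> assume c: "(U, \<phi>) \<in> A"
  show "smooth_on (\<lambda>y. \<psi> (inv_into U \<phi> y)) (\<phi> ` (U \<inter> W'))"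
    by (rule smooth_on_subset[OF sm_on_chartD[OF assms(1) c]]) (use assms(2) in auto)
qed

lemma sm_on_Union:
  assumes "\<And>W. W \<in> \<W> \<Longrightarrow> open W \<and> sm_on W \<psi>"
  shows "sm_on (\<Union>\<W>) \<psi>"
  unfolding sm_on_def
proof clarify
  fix U \<phi> assume c: "(U, \<phi>) \<in> A"
  have "smooth_on (\<lambda>y. \<psi> (inv_into U \<phi> y)) (\<Union>((\<lambda>W. \<phi> ` (U \<inter> W)) ` \<W>))"
    using assms chart_image_open[OF c] sm_on_chartD[OF _ c] by (intro smooth_on_Union) auto
  then show "smooth_on (\<lambda>y. \<psi> (inv_into U \<phi> y)) (\<phi> ` (U \<inter> \<Union>\<W>))"
    by (rule smooth_on_subset) auto
qed

lemma smooth_functionsI_local: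
  assumes "\<And>q. \<exists>W. open W \<and> q \<in> W \<and> sm_on W \<psi>"
  shows "\<psi> \<in> C"
proof -
  have "sm_on (\<Union>{W. open W \<and> sm_on W \<psi>}) \<psi>" by (rule sm_on_Union) auto
  moreover have "\<Union>{W. open W \<and> sm_on W \<psi>} = UNIV" using assms by blast
  ultimately show ?thesis by (simp add: smooth_functions_iff)
qed

lemma sm_on_smooth: "\<psi> \<in> C \<Longrightarrow> sm_on W \<psi>"
  using sm_on_subset[of UNIV \<psi> W] by (simp add: smooth_functions_iff)

lemma sm_on_const: "sm_on W (\<lambda>_. c)"
  unfolding sm_on_def by (simp add: smooth_on_const split_beta)

lemma sm_on_add:
  assumes "open W" "sm_on W \<psi>" "sm_on W \<xi>"
  shows "sm_on W (\<psi> + \<xi>)"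
  unfolding sm_on_def
proof clarify
  fix U \<phi> assume c: "(U, \<phi>) \<in> A"
  from smooth_on_add[OF chart_image_open[OF c assms(1)] sm_on_chartD[OF assms(2) c] sm_on_chartD[OF assms(3) c]]
  show "smooth_on (\<lambda>y. (\<psi> + \<xi>) (inv_into U \<phi> y)) (\<phi> ` (U \<inter> W))" by simp
qed

lemma sm_on_mult:
  assumes "open W" "sm_on W \<psi>" "sm_on W \<xi>"
  shows "sm_on W (\<psi> * \<xi>)"
  unfolding sm_on_def
proof clarify
  fix U \<phi> assume c: "(U, \<phi>) \<in> A"
  from smooth_on_mult[OF chart_image_open[OF c assms(1)] sm_on_chartD[OF assms(2) c] sm_on_chartD[OF assms(3) c]]
  show "smooth_on (\<lambda>y. (\<psi> * \<xi>) (inv_into U \<phi> y)) (\<phi> ` (U \<inter> W))" by simp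
qed

lemma sm_on_compose:
  fixes h :: "real \<Rightarrow> real"
  assumes "open W" "sm_on W \<psi>" "open T" "smooth_on h T" "\<psi> ` W \<subseteq> T"
  shows "sm_on W (\<lambda>q. h (\<psi> q))"
  unfolding sm_on_def
proof clarify
  fix U \<phi> assume c: "(U, \<phi>) \<in> A"
  show "smooth_on (\<lambda>y. h (\<psi> (inv_into U \<phi> y))) (\<phi> ` (U \<inter> W))"
    by (rule smooth_on_compose[OF chart_image_open[OF c assms(1)] assms(3) _ assms(4) sm_on_chartD[OF assms(2) c]])
      (use assms(5) chart_inv[OF c] in auto)
qed

lemma sm_on_continuous:
  assumes W: "open W" and s: "sm_on W \<psi>"
  shows "continuous_on W \<psi>"
proof -
  have "isCont \<psi> q" if q: "q \<in> W" for q
  proof -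
    obtain U \<phi> where c: "(U, \<phi>) \<in> A" and qU: "q \<in> U" by (rule chart_at)
    have "continuous_on (U \<inter> W) (\<lambda>r. \<psi> (inv_into U \<phi> (\<phi> r)))"
      by (rule continuous_on_compose2[OF smooth_on_continuous[OF sm_on_chartD[OF s c]]])
        (use chart_continuous[OF c] in \<open>auto intro: continuous_on_subset\<close>)
    then have "continuous_on (U \<inter> W) \<psi>"
      by (rule continuous_on_eq) (simp add: chart_inv[OF c])
    moreover have "open (U \<inter> W)" "q \<in> U \<inter> W" using q qU W chart_open[OF c] by auto
    ultimately show ?thesis using continuous_on_eq_continuous_at by blast
  qed
  then show ?thesis by (simp add: continuous_at_imp_continuous_on)
qed

section \<open>The algebra of smooth functions and its cut-offs\<close>

lemma smooth_const [simp]: "(\<lambda>_. c) \<in> C"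
  and smooth_add: "\<psi> \<in> C \<Longrightarrow> \<xi> \<in> C \<Longrightarrow> \<psi> + \<xi> \<in> C"
  and smooth_mult: "\<psi> \<in> C \<Longrightarrow> \<xi> \<in> C \<Longrightarrow> \<psi> * \<xi> \<in> C"
  unfolding smooth_functions_iff by (auto intro: sm_on_const sm_on_add sm_on_mult)

lemma smooth_zero [simp]: "0 \<in> C" and smooth_one [simp]: "1 \<in> C"
  unfolding zero_fun_def one_fun_def by (rule smooth_const)+

lemma smooth_uminus: "\<psi> \<in> C \<Longrightarrow> - \<psi> \<in> C"
proof -
  assume "\<psi> \<in> C"
  moreover have "(\<lambda>_. -1) * \<psi> = - \<psi>" by (simp add: fun_eq_iff)
  ultimately show ?thesis using smooth_mult[OF smooth_const[of "-1"]] by metis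
qed

lemma smooth_diff: "\<psi> \<in> C \<Longrightarrow> \<xi> \<in> C \<Longrightarrow> \<psi> - \<xi> \<in> C"
  using smooth_add[of \<psi> "- \<xi>"] smooth_uminus[of \<xi>] by simp

lemma smooth_sum: "(\<And>i. i \<in> I \<Longrightarrow> h i \<in> C) \<Longrightarrow> (\<Sum>i\<in>I. h i) \<in> C"
  by (induction I rule: infinite_finite_induct) (auto intro: smooth_add)

text \<open>The open sets \<open>W\<close> and \<open>- K\<close> cover the manifold. This is the
  smoothness test for products with a cut-off, whose other factor may be arbitrary outside
  \<open>W\<close>.\<close>

lemma smooth_functionsI_cover:
  assumes "open W" "closed K" "K \<subseteq> W" "sm_on W \<psi>" "\<And>q. q \<notin> K \<Longrightarrow> \<psi> q = 0"
  shows "\<psi> \<in> C"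
proof (rule smooth_functionsI_local)
  fix q
  have oK: "open (- K)" using assms(2) by (rule open_Compl)
  have sK: "sm_on (- K) \<psi>"
    by (rule sm_on_cong[OF oK _ sm_on_const[of _ 0]]) (use assms(5) in auto)
  show "\<exists>W. open W \<and> q \<in> W \<and> sm_on W \<psi>"
  proof (cases "q \<in> W")
    case True
    with assms(1,4) show ?thesis by (intro exI[of _ W]) simp
  next
    case False
    then have "q \<in> - K" using assms(3) by auto
    with oK sK show ?thesis by (intro exI[of _ "- K"]) simp
  qed
qed

lemma bump:
  assumes W: "open W" "p \<in> W"
  obtains b K W' where "b \<in> C" "closed K" "K \<subseteq> W" "\<forall>q. q \<notin> K \<longrightarrow> b q = 0"
    "open W'" "p \<in> W'" "W' \<subseteq> W" "\<forall>q\<in>W'. b q = 1"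
proof -
  obtain U \<phi> where c: "(U, \<phi>) \<in> A" and pU: "p \<in> U" by (rule chart_at)
  obtain r where r: "r > 0" "cball (\<phi> p) r \<subseteq> \<phi> ` (U \<inter> W)"
    using open_contains_cball_eq[OF chart_image_open[OF c W(1)]] pU W(2) by blast
  obtain h :: "real \<Rightarrow> real" where h: "smooth_on h UNIV" "\<forall>t\<le>1. h t = 1" "\<forall>t\<ge>2. h t = 0"
    by (rule smooth_cutoff)
  \<comment> \<open>A multiple of the squared distance, written in components so that its smoothness
    follows from the closure rules. The factor is fitted to the cut-off \<open>h\<close>:
    \<open>N\<close> is at most 1 on the ball of radius \<open>r / 2\<close> and at least 2 outside
    the ball of radius \<open>r\<close>.\<close>
  define N where "N y = (2 / r\<^sup>2) * (\<Sum>b\<in>Basis. ((y - \<phi> p) \<bullet> b) * ((y - \<phi> p) \<bullet> b))" for y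
  have N: "N y = 2 * (norm (y - \<phi> p) / r)\<^sup>2" for y
    by (simp add: N_def euclidean_inner[symmetric] power2_norm_eq_inner power_divide)
  define b where "b q = (if q \<in> U then h (N (\<phi> q)) else 0)" for q
  define K where "K = inv_into U \<phi> ` cball (\<phi> p) r"
  define W' where "W' = U \<inter> \<phi> -` ball (\<phi> p) (r / 2)"
  have KU: "K \<subseteq> U \<inter> W" using r(2) chart_inv[OF c] by (force simp: K_def)
  \<comment> \<open>The preimage of a closed set under a chart need not be closed in the manifold;
    for \<open>K\<close> this follows from compactness of the ball and the Hausdorff
    property.\<close>
  have "compact K" unfolding K_def
    by (rule compact_continuous_image[OF continuous_on_subset[OF chart_inv_continuous[OF c]] compact_cball])
      (use r in auto)
  then have K: "closed K" by (rule compact_imp_closed)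
  have memK: "q \<in> K" if "q \<in> U" "norm (\<phi> q - \<phi> p) \<le> r" for q
    using that chart_inv[OF c that(1)] unfolding K_def
    by (intro image_eqI[of _ _ "\<phi> q"]) (auto simp: dist_norm norm_minus_commute)
  have zero: "b q = 0" if "q \<notin> K" for q
  proof (cases "q \<in> U")
    case True
    then have "1 \<le> norm (\<phi> q - \<phi> p) / r" using memK that r(1) by (force simp: field_simps)
    then have "2 \<le> N (\<phi> q)" unfolding N by (simp add: one_le_power)
    then show ?thesis using True h(3) by (simp add: b_def)
  qed (simp add: b_def)
  have one: "b q = 1" if "q \<in> W'" for q
  proof -
    have "norm (\<phi> q - \<phi> p) / r \<le> 1 / 2" using that r(1) by (auto simp: W'_def dist_norm norm_minus_commute field_simps)
    then have "(norm (\<phi> q - \<phi> p) / r)\<^sup>2 \<le> (1 / 2)\<^sup>2" using r(1) by (intro power_mono) auto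
    also have "(1 / 2)\<^sup>2 = (1 / 4::real)" by (simp add: power2_eq_square)
    finally have "N (\<phi> q) \<le> 1" unfolding N by linarith
    then show ?thesis using that h(2) by (simp add: b_def W'_def)
  qed
  have id: "smooth_on (\<lambda>y. y + (- \<phi> p)) (\<phi> ` U)"
    by (intro smooth_on_add smooth_on_id smooth_on_const chart_open_image[OF c])
  have "smooth_on N (\<phi> ` U)" unfolding N_def diff_conv_add_uminus
    by (intro smooth_on_mult smooth_on_const smooth_on_sum chart_open_image[OF c]
        smooth_on_bounded_linear[OF bounded_linear_inner_left] id)
  then have "smooth_on (\<lambda>y. h (N y)) (\<phi> ` U)"
    using smooth_on_compose[OF chart_open_image[OF c] open_UNIV _ h(1)] by blast
  then have "sm_on U (\<lambda>q. h (N (\<phi> q)))" by (rule sm_on_chartI[OF c chart_open[OF c] subset_refl])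
  then have "sm_on U b" by (rule sm_on_cong[OF chart_open[OF c], rotated]) (simp add: b_def)
  then have "b \<in> C" using KU zero K chart_open[OF c] by (intro smooth_functionsI_cover[of U K]) auto
  moreover have "open W'" unfolding W'_def by (rule chart_preimage_open[OF c open_ball])
  moreover have "p \<in> W'" using pU r by (simp add: W'_def)
  moreover have "W' \<subseteq> W" using KU memK r(1) by (force simp: W'_def dist_norm norm_minus_commute)
  ultimately show ?thesis using that[of b K W'] K KU zero one by blast
qed

text \<open>A product with a cut-off preserves only the germ of \<open>u\<close> at
  \<open>p\<close>, but it is a global function, and so one on which derivations can act.\<close>

lemma extension:
  assumes W: "open W" "p \<in> W" and u: "sm_on W u"
  obtains u' W' where "u' \<in> C" "open W'" "p \<in> W'" "W' \<subseteq> W" "\<forall>q\<in>W'. u' q = u q"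
proof -
  obtain b K W' where b: "b \<in> C" "closed K" "K \<subseteq> W" "\<forall>q. q \<notin> K \<longrightarrow> b q = 0"
    "open W'" "p \<in> W'" "W' \<subseteq> W" "\<forall>q\<in>W'. b q = 1" by (rule bump[OF W])
  have "b * u \<in> C"
    by (rule smooth_functionsI_cover[OF W(1) b(2,3) sm_on_mult[OF W(1) sm_on_smooth[OF b(1)] u]])
      (use b(4) in auto)
  then show ?thesis using that[of "b * u" W'] b by auto
qed

section \<open>Derivations: locality, module structure and coordinate expansion\<close>

lemma vf_smooth: "X \<in> V \<Longrightarrow> \<psi> \<in> C \<Longrightarrow> X \<psi> \<in> C"
  and vf_nonsmooth: "X \<in> V \<Longrightarrow> \<psi> \<notin> C \<Longrightarrow> X \<psi> = 0"
  and vf_plus: "X \<in> V \<Longrightarrow> \<psi> \<in> C \<Longrightarrow> \<xi> \<in> C \<Longrightarrow> X (\<psi> + \<xi>) = X \<psi> + X \<xi>"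
  and vf_mult: "X \<in> V \<Longrightarrow> \<psi> \<in> C \<Longrightarrow> \<xi> \<in> C \<Longrightarrow> X (\<psi> * \<xi>) = X \<psi> * \<xi> + \<psi> * X \<xi>"
  unfolding vector_fields_def by auto

lemma vf_cmult: "X \<in> V \<Longrightarrow> \<psi> \<in> C \<Longrightarrow> X ((\<lambda>_. c) * \<psi>) = (\<lambda>_. c) * X \<psi>"
  unfolding vector_fields_def by auto

lemma vf_const: assumes "X \<in> V" shows "X (\<lambda>_. c) = 0"
proof -
  have "X 1 = 0" using vf_mult[OF assms smooth_one smooth_one] by simp
  then show ?thesis using vf_cmult[OF assms smooth_one, of c] by simp
qed

lemma vf_zero: "X \<in> V \<Longrightarrow> X 0 = 0"
  using vf_const[of X 0] by (simp add: zero_fun_def)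

lemma vf_uminus: "X \<in> V \<Longrightarrow> \<psi> \<in> C \<Longrightarrow> X (- \<psi>) = - X \<psi>"
proof -
  assume *: "X \<in> V" "\<psi> \<in> C"
  have "(\<lambda>_. -1) * \<psi> = - \<psi>" for \<psi> :: "'m \<Rightarrow> real" by (simp add: fun_eq_iff)
  with vf_cmult[OF *, of "-1"] show ?thesis by simp
qed

lemma vf_minus: "X \<in> V \<Longrightarrow> \<psi> \<in> C \<Longrightarrow> \<xi> \<in> C \<Longrightarrow> X (\<psi> - \<xi>) = X \<psi> - X \<xi>"
  using vf_plus[of X \<psi> "- \<xi>"] by (simp add: vf_uminus smooth_uminus fun_eq_iff)

lemma vf_sum: "X \<in> V \<Longrightarrow> (\<And>i. i \<in> I \<Longrightarrow> h i \<in> C) \<Longrightarrow> X (\<Sum>i\<in>I. h i) = (\<Sum>i\<in>I. X (h i))"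
  by (induction I rule: infinite_finite_induct) (auto simp: vf_zero vf_plus smooth_sum)

text \<open>A suitable cut-off times \<open>\<psi> - \<xi>\<close> is identically zero; in the
  Leibniz rule at \<open>q\<close> the cut-off is 1 and the difference is 0, so only
  \<open>X (\<psi> - \<xi>) q\<close> is left.\<close>

lemma vf_local:
  assumes X: "X \<in> V" and W: "open W" "q \<in> W" and s: "\<psi> \<in> C" "\<xi> \<in> C"
    and eq: "\<And>r. r \<in> W \<Longrightarrow> \<psi> r = \<xi> r"
  shows "X \<psi> q = X \<xi> q"
proof -
  obtain b K W' where b: "b \<in> C" "closed K" "K \<subseteq> W" "\<forall>q. q \<notin> K \<longrightarrow> b q = 0"
    "open W'" "q \<in> W'" "W' \<subseteq> W" "\<forall>q\<in>W'. b q = 1" by (rule bump[OF W])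
  have "b * (\<psi> - \<xi>) = 0" using b eq by (auto simp: fun_eq_iff)
  then have "X (b * (\<psi> - \<xi>)) q = 0" using vf_zero[OF X] by simp
  then show ?thesis using b s eq[OF W(2)] by (simp add: vf_mult vf_minus X smooth_diff)
qed

lemma vf_ext:
  "X \<in> V \<Longrightarrow> Y \<in> V \<Longrightarrow> (\<And>\<psi> q. \<psi> \<in> C \<Longrightarrow> X \<psi> q = Y \<psi> q) \<Longrightarrow> X = Y"
  by (rule ext, rule ext, case_tac "x \<in> C") (simp_all add: vf_nonsmooth)

lemma vector_fieldsI:
  assumes "\<And>\<psi>. \<psi> \<in> C \<Longrightarrow> X \<psi> \<in> C" "\<And>\<psi>. \<psi> \<notin> C \<Longrightarrow> X \<psi> = 0"
    "\<And>\<psi> \<xi>. \<psi> \<in> C \<Longrightarrow> \<xi> \<in> C \<Longrightarrow> X (\<psi> + \<xi>) = X \<psi> + X \<xi>"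
    "\<And>\<psi> c. \<psi> \<in> C \<Longrightarrow> X ((\<lambda>_. c) * \<psi>) = (\<lambda>_. c) * X \<psi>"
    "\<And>\<psi> \<xi>. \<psi> \<in> C \<Longrightarrow> \<xi> \<in> C \<Longrightarrow> X (\<psi> * \<xi>) = X \<psi> * \<xi> + \<psi> * X \<xi>"
  shows "X \<in> V"
  unfolding vector_fields_def mem_Collect_eq using assms by simp

lemma vector_fields_add:
  assumes X: "X \<in> V" and Y: "Y \<in> V"
  shows "X + Y \<in> V"
proof (rule vector_fieldsI, goal_cases)
  case (1 \<psi>) then show ?case by (simp add: smooth_add vf_smooth X Y)
next
  case (2 \<psi>) then show ?case by (simp add: vf_nonsmooth X Y fun_eq_iff)
next
  case (3 \<psi> \<xi>)
  show ?case unfolding plus_fun_apply vf_plus[OF X 3] vf_plus[OF Y 3] by (simp add: algebra_simps)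
next
  case (4 \<psi> c)
  show ?case unfolding plus_fun_apply vf_cmult[OF X 4] vf_cmult[OF Y 4] by (simp add: fun_eq_iff algebra_simps)
next
  case (5 \<psi> \<xi>)
  show ?case unfolding plus_fun_apply vf_mult[OF X 5] vf_mult[OF Y 5] by (simp add: fun_eq_iff algebra_simps)
qed

lemma vector_fields_scale:
  assumes X: "X \<in> V" and s: "\<zeta> \<in> C"
  shows "\<zeta> \<odot> X \<in> V"
  unfolding fscale_def
proof (rule vector_fieldsI, goal_cases)
  case (1 \<psi>) then show ?case by (simp add: smooth_mult vf_smooth X s)
next
  case (2 \<psi>) then show ?case by (simp add: vf_nonsmooth X fun_eq_iff)
next
  case (3 \<psi> \<xi>)
  show ?case unfolding vf_plus[OF X 3] by (simp add: algebra_simps)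
next
  case (4 \<psi> c)
  show ?case unfolding vf_cmult[OF X 4] by (simp add: algebra_simps)
next
  case (5 \<psi> \<xi>)
  show ?case unfolding vf_mult[OF X 5] by (simp add: algebra_simps)
qed

lemma vector_fields_zero: "0 \<in> V"
  by (rule vector_fieldsI) auto

lemma vector_fields_uminus:
  assumes X: "X \<in> V" shows "- X \<in> V"
proof -
  have "- X = (\<lambda>_. -1) \<odot> X" by (simp add: fscale_def fun_eq_iff)
  then show ?thesis using vector_fields_scale[OF X smooth_const[of "-1"]] by metis
qed

lemma vector_fields_diff: "X \<in> V \<Longrightarrow> Y \<in> V \<Longrightarrow> X - Y \<in> V"
  using vector_fields_add[of X "- Y"] vector_fields_uminus[of Y] by simp

lemma vector_fields_sum: "(\<And>i. i \<in> I \<Longrightarrow> X i \<in> V) \<Longrightarrow> (\<Sum>i\<in>I. X i) \<in> V"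
  by (induction I rule: infinite_finite_induct) (auto intro: vector_fields_add vector_fields_zero)

text \<open>The fields \<open>E b\<close> are cut-off partial derivatives and the \<open>x b\<close>
  are globally extended coordinates. The expansion of an arbitrary derivation is Hadamard's lemma at
  \<open>q\<close>: near \<open>q\<close>, \<open>\<psi>\<close> is a constant plus the sum of the
  products \<open>(x b - x b q) * u b\<close>, and \<open>u b\<close> takes at \<open>q\<close> the
  value of the \<open>b\<close>-th partial derivative.\<close>

lemma coordinates:
  obtains U x E where "open U" "p \<in> U" "\<forall>b\<in>Basis. x b \<in> C" "\<forall>b\<in>Basis. E b \<in> V"
    "\<forall>X\<in>V. \<forall>\<psi>\<in>C. \<forall>q\<in>U. X \<psi> q = (\<Sum>b\<in>(Basis::'e set). X (x b) q * E b \<psi> q)"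
    "\<forall>b\<in>Basis. \<forall>c\<in>Basis. \<forall>q\<in>U. E b (x c) q = (if b = c then 1 else 0)"
proof -
  obtain D \<phi> where c: "(D, \<phi>) \<in> A" and pD: "p \<in> D" by (rule chart_at)
  note oD = chart_open[OF c]
  have "\<exists>u W. u \<in> C \<and> open W \<and> p \<in> W \<and> W \<subseteq> D \<and> (\<forall>q\<in>W. u q = \<phi> q \<bullet> b)" for b
  proof -
    have "smooth_on (\<lambda>y. y \<bullet> b) (\<phi> ` D)"
      by (intro smooth_on_bounded_linear[OF bounded_linear_inner_left] smooth_on_id chart_open_image[OF c])
    then have "sm_on D (\<lambda>q. \<phi> q \<bullet> b)" by (rule sm_on_chartI[OF c oD subset_refl])
    then show ?thesis by (rule extension[OF oD pD]) blast
  qed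
  then obtain x W where x: "\<And>b. x b \<in> C" "\<And>b. open (W b)" "\<And>b. p \<in> W b" "\<And>b. W b \<subseteq> D"
    "\<And>b q. q \<in> W b \<Longrightarrow> x b q = \<phi> q \<bullet> b" by metis
  obtain \<beta> K W0 where \<beta>: "\<beta> \<in> C" "closed K" "K \<subseteq> D" "\<forall>q. q \<notin> K \<longrightarrow> \<beta> q = 0"
    "open W0" "p \<in> W0" "W0 \<subseteq> D" "\<forall>q\<in>W0. \<beta> q = 1" by (rule bump[OF oD pD])
  define U where "U = W0 \<inter> (\<Inter>b\<in>Basis. W b)"
  have oU: "open U" and pU: "p \<in> U" and UD: "U \<subseteq> D"
    unfolding U_def using x \<beta> by (auto intro!: open_Int open_INT)
  define d where "d \<psi> q = frechet_derivative (\<lambda>y. \<psi> (inv_into D \<phi> y)) (at (\<phi> q))" for \<psi> :: "'m \<Rightarrow> real" and q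
  have sm: "smooth_on (\<lambda>y. \<psi> (inv_into D \<phi> y)) (\<phi> ` D)" if "\<psi> \<in> C" for \<psi>
    using sm_on_chartD[OF _ c, of UNIV \<psi>] that by (simp add: smooth_functions_iff)
  have d: "((\<lambda>y. \<psi> (inv_into D \<phi> y)) has_derivative d \<psi> q) (at (\<phi> q))" if "\<psi> \<in> C" "q \<in> D" for \<psi> q
    unfolding d_def using smooth_on_has_derivative[OF sm[OF that(1)] chart_open_image[OF c]] that by blast
  have d_eq: "d \<psi> q = d'" if "((\<lambda>y. \<psi> (inv_into D \<phi> y)) has_derivative d') (at (\<phi> q))" for \<psi> q d'
    unfolding d_def using frechet_derivative_at[OF that] by simp
  have d_add: "d (\<psi> + \<xi>) q b = d \<psi> q b + d \<xi> q b" if "\<psi> \<in> C" "\<xi> \<in> C" "q \<in> D" for \<psi> \<xi> q b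
    using d_eq[of "\<psi> + \<xi>" _ q] has_derivative_add[OF d[OF that(1,3)] d[OF that(2,3)]] by simp
  have d_mult: "d (\<psi> * \<xi>) q b = d \<psi> q b * \<xi> q + \<psi> q * d \<xi> q b" if "\<psi> \<in> C" "\<xi> \<in> C" "q \<in> D" for \<psi> \<xi> q b
    using d_eq[of "\<psi> * \<xi>" _ q] has_derivative_mult[OF d[OF that(1,3)] d[OF that(2,3)]] chart_inv[OF c that(3)]
    by simp
  have d_const: "d (\<lambda>_. r) q b = 0" for r q b by (simp add: d_eq[OF has_derivative_const])
  have d_cmult: "d ((\<lambda>_. r) * \<psi>) q b = r * d \<psi> q b" if "\<psi> \<in> C" "q \<in> D" for \<psi> r q b
    using d_mult[OF smooth_const that] by (simp add: d_const)
  \<comment> \<open>The outer default is demanded by \<open>vector_fields\<close>. The inner one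
    extends the field smoothly across the boundary of \<open>D\<close>, since \<open>\<beta>\<close>
    vanishes off the closed set \<open>K\<close> inside \<open>D\<close>.\<close>
  define E where "E b \<psi> = (if \<psi> \<in> C then (\<lambda>q. if q \<in> D then \<beta> q * d \<psi> q b else 0) else 0)" for b \<psi>
  have E: "E b \<in> V" for b
    unfolding vector_fields_def mem_Collect_eq
  proof (intro conjI ballI allI impI)
    fix \<psi> assume \<psi>: "\<psi> \<in> C"
    have "sm_on D (\<lambda>q. d \<psi> q b)"
      unfolding d_def using smooth_on_derivative[OF sm[OF \<psi>], of b] by (rule sm_on_chartI[OF c oD subset_refl])
    from sm_on_mult[OF oD sm_on_smooth[OF \<beta>(1)] this]
    have "sm_on D (E b \<psi>)" by (rule sm_on_cong[OF oD, rotated]) (simp add: E_def \<psi>)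
    then show "E b \<psi> \<in> C"
      by (rule smooth_functionsI_cover[OF oD \<beta>(2,3)]) (use \<beta>(4) in \<open>auto simp: E_def\<close>)
  next
    fix \<psi> \<xi> assume s: "\<psi> \<in> C" "\<xi> \<in> C"
    show "E b (\<psi> + \<xi>) = E b \<psi> + E b \<xi>"
      using s smooth_add[OF s] d_add[OF s] by (auto simp: E_def fun_eq_iff algebra_simps)
    show "E b (\<psi> * \<xi>) = E b \<psi> * \<xi> + \<psi> * E b \<xi>"
      using s smooth_mult[OF s] d_mult[OF s] by (auto simp: E_def fun_eq_iff algebra_simps)
  next
    fix \<psi> r assume s: "\<psi> \<in> C"
    show "E b ((\<lambda>_. r) * \<psi>) = (\<lambda>_. r) * E b \<psi>"
      using s smooth_mult[OF smooth_const s] d_cmult[OF s] by (auto simp: E_def fun_eq_iff)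
  qed (simp add: E_def)
  have E_at: "E b \<psi> q = d \<psi> q b" if "\<psi> \<in> C" "q \<in> U" for b \<psi> q
    using that UD \<beta>(8) by (auto simp: E_def U_def)
  have "X \<psi> q = (\<Sum>b\<in>Basis. X (x b) q * E b \<psi> q)" if X: "X \<in> V" and \<psi>: "\<psi> \<in> C" and q: "q \<in> U" for X \<psi> q
  proof -
    have qD: "q \<in> D" using q UD by blast
    \<comment> \<open>A ball, because Hadamard's lemma needs a convex domain; inside the image of
      \<open>U\<close>, because there the \<open>x b\<close> are the true coordinates.\<close>
    obtain r where r: "r > 0" "ball (\<phi> q) r \<subseteq> \<phi> ` (D \<inter> U)"
      by (rule openE[OF chart_image_open[OF c oU], of "\<phi> q"]) (use q qD in auto)
    have bD: "ball (\<phi> q) r \<subseteq> \<phi> ` D" using r by blast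
    obtain G where G: "\<And>b. smooth_on (G b) (ball (\<phi> q) r)" "\<And>b. G b (\<phi> q) = d \<psi> q b"
      "\<And>y. y \<in> ball (\<phi> q) r \<Longrightarrow> \<psi> (inv_into D \<phi> y) = \<psi> q + (\<Sum>b\<in>Basis. ((y - \<phi> q) \<bullet> b) * G b y)"
      using hadamard[OF open_ball convex_ball _ smooth_on_subset[OF sm[OF \<psi>] bD], of "\<phi> q"]
        chart_inv[OF c qD] r(1) unfolding d_def by (auto simp del: chart_inv)
    define B where "B = D \<inter> \<phi> -` ball (\<phi> q) r"
    have oB: "open B" and qB: "q \<in> B" and BD: "B \<subseteq> D"
      unfolding B_def using chart_preimage_open[OF c open_ball] r(1) qD by auto
    have BU: "B \<subseteq> U"
    proof
      fix s assume s: "s \<in> B"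
      then obtain t where "t \<in> D \<inter> U" "\<phi> s = \<phi> t" using r(2) by (auto simp: B_def)
      then show "s \<in> U" using chart_inv[OF c, of s] chart_inv[OF c, of t] s BD by auto
    qed
    \<comment> \<open>The Hadamard factors \<open>G b\<close> live only on the ball, whereas
      \<open>X\<close> acts on global functions, so their germs at \<open>q\<close> are
      extended.\<close>
    have "\<exists>u W. u \<in> C \<and> open W \<and> q \<in> W \<and> W \<subseteq> B \<and> (\<forall>s\<in>W. u s = G b (\<phi> s))" for b
    proof -
      have "sm_on B (\<lambda>s. G b (\<phi> s))"
        by (rule sm_on_chartI[OF c oB BD smooth_on_subset[OF G(1)]]) (auto simp: B_def)
      then show ?thesis by (rule extension[OF oB qB]) blast
    qed
    then obtain u Y where u: "\<And>b. u b \<in> C" "\<And>b. open (Y b)" "\<And>b. q \<in> Y b" "\<And>b. Y b \<subseteq> B"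
      "\<And>b s. s \<in> Y b \<Longrightarrow> u b s = G b (\<phi> s)" by metis
    define Z where "Z = B \<inter> (\<Inter>b\<in>Basis. Y b)"
    have Z: "open Z" "q \<in> Z" unfolding Z_def using u oB qB by (auto intro!: open_Int open_INT)
    have s: "(\<lambda>_. \<psi> q) + (\<Sum>b\<in>Basis. (x b - (\<lambda>_. x b q)) * u b) \<in> C"
      by (intro smooth_add smooth_sum smooth_mult smooth_diff smooth_const x u)
    have "\<psi> s = ((\<lambda>_. \<psi> q) + (\<Sum>b\<in>Basis. (x b - (\<lambda>_. x b q)) * u b)) s" if "s \<in> Z" for s
    proof -
      have sB: "s \<in> B" and "s \<in> U" using that BU by (auto simp: Z_def)
      then have "\<psi> s = \<psi> q + (\<Sum>b\<in>Basis. ((\<phi> s - \<phi> q) \<bullet> b) * G b (\<phi> s))"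
        using G(3)[of "\<phi> s"] chart_inv[OF c, of s] BD by (auto simp: B_def)
      also have "(\<Sum>b\<in>Basis. ((\<phi> s - \<phi> q) \<bullet> b) * G b (\<phi> s)) = (\<Sum>b\<in>Basis. (x b s - x b q) * u b s)"
        using that q \<open>s \<in> U\<close> u(5) x(5) by (intro sum.cong) (auto simp: Z_def U_def inner_diff_left)
      finally show ?thesis by simp
    qed
    from vf_local[OF X Z \<psi> s this]
    have "X \<psi> q = X ((\<lambda>_. \<psi> q) + (\<Sum>b\<in>Basis. (x b - (\<lambda>_. x b q)) * u b)) q" .
    \<comment> \<open>The factors \<open>x b - x b q\<close> vanish at \<open>q\<close>, so the
      Leibniz rule leaves only the terms that differentiate them.\<close>
    also have "\<dots> = (\<Sum>b\<in>Basis. X (x b) q * u b q)"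
      by (simp add: vf_plus vf_sum vf_const vf_mult vf_minus X x u smooth_sum smooth_mult smooth_diff)
    also have "\<dots> = (\<Sum>b\<in>Basis. X (x b) q * E b \<psi> q)"
      using u(3,5) G(2) E_at[OF \<psi> q] by simp
    finally show ?thesis .
  qed
  moreover have "E b (x e) q = (if b = e then 1 else 0)" if "b \<in> Basis" "e \<in> Basis" "q \<in> U" for b e q
  proof -
    have qD: "q \<in> D" using that UD by blast
    have "((\<lambda>y. y \<bullet> e) has_derivative (\<lambda>v. v \<bullet> e)) (at (\<phi> q))" by (auto intro!: derivative_eq_intros)
    then have "((\<lambda>y. x e (inv_into D \<phi> y)) has_derivative (\<lambda>v. v \<bullet> e)) (at (\<phi> q))"
      by (rule has_derivative_transform_within_open[OF _ chart_image_open[OF c oU]])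
        (use that qD x(5) chart_inv[OF c] in \<open>auto simp: U_def\<close>)
    then show ?thesis using E_at[OF x(1) that(3)] d_eq that by (simp add: inner_Basis)
  qed
  ultimately show ?thesis by (intro that[of U x E] oU pU x(1) E ballI)
qed

end

section \<open>Tensors, orthonormal frames and traces\<close>

context manifold
begin

lemma tuples_update: "Xs \<in> tuples A k \<Longrightarrow> Y \<in> V \<Longrightarrow> Xs[i := Y] \<in> tuples A k"
  unfolding tuples_def using set_update_subset_insert[of Xs i Y] by auto

lemma tuples_nth: "Xs \<in> tuples A k \<Longrightarrow> i < k \<Longrightarrow> Xs ! i \<in> V"
  unfolding tuples_def by auto

lemma tuples_length: "Xs \<in> tuples A k \<Longrightarrow> length Xs = k"
  unfolding tuples_def by auto

lemma tuples_pair: "X \<in> V \<Longrightarrow> Y \<in> V \<Longrightarrow> [X, Y] \<in> tuples A 2"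
  unfolding tuples_def by auto

lemma tensor_smooth: "S \<in> tensors A k \<Longrightarrow> Xs \<in> tuples A k \<Longrightarrow> S Xs \<in> C"
  unfolding tensors_def by auto

lemma tensor_add:
  "S \<in> tensors A k \<Longrightarrow> Xs \<in> tuples A k \<Longrightarrow> i < k \<Longrightarrow> Y \<in> V \<Longrightarrow> Z \<in> V \<Longrightarrow>
    S (Xs[i := Y + Z]) = S (Xs[i := Y]) + S (Xs[i := Z])"
  unfolding tensors_def by auto

lemma tensor_scale:
  "S \<in> tensors A k \<Longrightarrow> Xs \<in> tuples A k \<Longrightarrow> i < k \<Longrightarrow> Y \<in> V \<Longrightarrow> \<psi> \<in> C \<Longrightarrow>
    S (Xs[i := \<psi> \<odot> Y]) = \<psi> * S (Xs[i := Y])"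
  unfolding tensors_def by auto

lemma tensorsI:
  assumes "\<And>Xs. Xs \<in> tuples A k \<Longrightarrow> S Xs \<in> C"
    "\<And>Xs i Y Z. Xs \<in> tuples A k \<Longrightarrow> i < k \<Longrightarrow> Y \<in> V \<Longrightarrow> Z \<in> V \<Longrightarrow>
      S (Xs[i := Y + Z]) = S (Xs[i := Y]) + S (Xs[i := Z])"
    "\<And>Xs i Y \<psi>. Xs \<in> tuples A k \<Longrightarrow> i < k \<Longrightarrow> Y \<in> V \<Longrightarrow> \<psi> \<in> C \<Longrightarrow>
      S (Xs[i := \<psi> \<odot> Y]) = \<psi> * S (Xs[i := Y])"
  shows "S \<in> tensors A k"
  unfolding tensors_def using assms by auto

section \<open>Linearity over the smooth functions and dependence on point values only\<close>

context
  fixes S k Xs i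
  assumes S: "S \<in> tensors A k" and Xs: "Xs \<in> tuples A k" and i: "i < k"
begin

lemma tensor_zero: "S (Xs[i := 0]) = 0"
proof -
  have "(0::'m vfield) = (0::'m \<Rightarrow> real) \<odot> 0" unfolding fscale_def by (rule ext)+ simp
  then show ?thesis using tensor_scale[OF S Xs i vector_fields_zero smooth_zero] by simp
qed

lemma tensor_sum:
  "(\<And>l. l \<in> I \<Longrightarrow> \<psi> l \<in> C) \<Longrightarrow> (\<And>l. l \<in> I \<Longrightarrow> Y l \<in> V) \<Longrightarrow>
    S (Xs[i := \<Sum>l\<in>I. \<psi> l \<odot> Y l]) = (\<Sum>l\<in>I. \<psi> l * S (Xs[i := Y l]))"
proof (induction I rule: infinite_finite_induct)
  case (insert l I)
  then have "(\<Sum>l\<in>I. \<psi> l \<odot> Y l) \<in> V" "\<psi> l \<odot> Y l \<in> V"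
    by (auto intro!: vector_fields_sum vector_fields_scale)
  with insert show ?case
    by (simp add: tensor_add[OF S Xs i] tensor_scale[OF S Xs i] del: plus_fun_apply sum_fun_apply times_fun_apply)
qed (simp_all add: tensor_zero)

lemma tensor_uminus: "Y \<in> V \<Longrightarrow> S (Xs[i := - Y]) = - S (Xs[i := Y])"
proof -
  assume Y: "Y \<in> V"
  have "- Y = (\<lambda>_. -1) \<odot> Y" by (simp add: fscale_def fun_eq_iff)
  then have "S (Xs[i := - Y]) = (\<lambda>_. -1) * S (Xs[i := Y])"
    using tensor_scale[OF S Xs i Y smooth_const[of "-1"]] by metis
  then show ?thesis by (simp add: fun_eq_iff)
qed

lemma tensor_diff: "Y \<in> V \<Longrightarrow> Z \<in> V \<Longrightarrow> S (Xs[i := Y - Z]) = S (Xs[i := Y]) - S (Xs[i := Z])"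
  using tensor_add[OF S Xs i _ vector_fields_uminus, of Y Z] tensor_uminus[of Z] by simp

text \<open>Cut off by \<open>\<beta>\<close>, the coordinate expansion of \<open>Y\<close> becomes
  an identity of global fields, to which linearity over the smooth functions applies; all its
  coefficients \<open>\<beta> * Y (x b)\<close> vanish at \<open>q\<close>.\<close>

lemma tensor_zero_at:
  assumes Y: "Y \<in> V" and zero: "\<And>\<psi>. \<psi> \<in> C \<Longrightarrow> Y \<psi> q = 0"
  shows "S (Xs[i := Y]) q = 0"
proof -
  obtain U x E where U: "open U" "q \<in> U" "\<And>b. b \<in> Basis \<Longrightarrow> x b \<in> C" "\<And>b. b \<in> Basis \<Longrightarrow> E b \<in> V"
    "\<And>X \<psi> q. X \<in> V \<Longrightarrow> \<psi> \<in> C \<Longrightarrow> q \<in> U \<Longrightarrow> X \<psi> q = (\<Sum>b\<in>(Basis::'e set). X (x b) q * E b \<psi> q)"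
    by (rule coordinates[of q]) blast
  obtain \<beta> K W where \<beta>: "\<beta> \<in> C" "closed K" "K \<subseteq> U" "\<forall>q. q \<notin> K \<longrightarrow> \<beta> q = 0"
    "open W" "q \<in> W" "W \<subseteq> U" "\<forall>q\<in>W. \<beta> q = 1" by (rule bump[OF U(1,2)])
  have cf: "\<beta> * Y (x b) \<in> C" if "b \<in> Basis" for b
    using \<beta>(1) vf_smooth[OF Y U(3)[OF that]] by (rule smooth_mult)
  have "\<beta> \<odot> Y = (\<Sum>b\<in>Basis. (\<beta> * Y (x b)) \<odot> E b)"
  proof (rule vf_ext)
    fix \<psi> r assume \<psi>: "\<psi> \<in> C"
    show "(\<beta> \<odot> Y) \<psi> r = (\<Sum>b\<in>Basis. (\<beta> * Y (x b)) \<odot> E b) \<psi> r"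
    proof (cases "r \<in> U")
      case True
      then show ?thesis using U(5)[OF Y \<psi> True]
        by (simp add: fscale_def sum_distrib_left mult.assoc)
    next
      case False
      then show ?thesis using \<beta>(3,4) by (auto simp: fscale_def)
    qed
  qed (use Y \<beta>(1) U(4) cf in \<open>auto intro!: vector_fields_scale vector_fields_sum\<close>)
  then have "\<beta> * S (Xs[i := Y]) = (\<Sum>b\<in>Basis. (\<beta> * Y (x b)) * S (Xs[i := E b]))"
    using tensor_scale[OF S Xs i Y \<beta>(1)] tensor_sum[of Basis "\<lambda>b. \<beta> * Y (x b)" E] cf U(4) by simp
  then have "(\<beta> * S (Xs[i := Y])) q = 0" using zero U(3) by simp
  then show ?thesis using \<beta>(6,8) by simp
qed

lemma tensor_eq_at:
  assumes Y: "Y \<in> V" and Z: "Z \<in> V" and eq: "\<And>\<psi>. \<psi> \<in> C \<Longrightarrow> Y \<psi> q = Z \<psi> q"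
  shows "S (Xs[i := Y]) q = S (Xs[i := Z]) q"
proof -
  have "S (Xs[i := Y - Z]) q = 0"
    by (rule tensor_zero_at[OF vector_fields_diff[OF Y Z]]) (simp add: eq)
  then show ?thesis using tensor_diff[OF Y Z] by simp
qed

end

end

section \<open>Orthonormal frames of a Riemannian metric\<close>

locale riemannian = manifold A
  for A :: "('m::{t2_space,second_countable_topology}, 'e::euclidean_space) atlas" +
  fixes g :: "'m tensor"
  assumes metric: "riemannian_metric A g"
begin

lemma g_tensor: "g \<in> tensors A 2"
  and g_sym: "X \<in> V \<Longrightarrow> Y \<in> V \<Longrightarrow> g [X, Y] = g [Y, X]"
  and g_pos: "X \<in> V \<Longrightarrow> \<psi> \<in> C \<Longrightarrow> X \<psi> p \<noteq> 0 \<Longrightarrow> g [X, X] p > 0"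
  using metric unfolding riemannian_metric_def by blast+

lemma tensor2_smooth: "S \<in> tensors A 2 \<Longrightarrow> X \<in> V \<Longrightarrow> Y \<in> V \<Longrightarrow> S [X, Y] \<in> C"
  by (rule tensor_smooth[OF _ tuples_pair])

lemma g_diff_left: "X \<in> V \<Longrightarrow> Y \<in> V \<Longrightarrow> Z \<in> V \<Longrightarrow> g [X - Y, Z] = g [X, Z] - g [Y, Z]"
  using tensor_diff[OF g_tensor tuples_pair, of X Z 0 X Y] by simp

lemma g_add_left: "X \<in> V \<Longrightarrow> Y \<in> V \<Longrightarrow> Z \<in> V \<Longrightarrow> g [X + Y, Z] = g [X, Z] + g [Y, Z]"
  using tensor_add[OF g_tensor tuples_pair, of X Z 0 X Y] by simp

lemma g_uminus_left: "X \<in> V \<Longrightarrow> Z \<in> V \<Longrightarrow> g [- X, Z] = - g [X, Z]"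
  using tensor_uminus[OF g_tensor tuples_pair, of X Z 0 X] by simp

lemma g_scale_left: "X \<in> V \<Longrightarrow> Z \<in> V \<Longrightarrow> \<psi> \<in> C \<Longrightarrow> g [\<psi> \<odot> X, Z] = \<psi> * g [X, Z]"
  using tensor_scale[OF g_tensor tuples_pair, of X Z 0 X \<psi>] by simp

lemma g_sum_left:
  "Z \<in> V \<Longrightarrow> (\<And>l. l \<in> I \<Longrightarrow> \<psi> l \<in> C) \<Longrightarrow> (\<And>l. l \<in> I \<Longrightarrow> Y l \<in> V) \<Longrightarrow>
    g [\<Sum>l\<in>I. \<psi> l \<odot> Y l, Z] = (\<Sum>l\<in>I. \<psi> l * g [Y l, Z])"
  using tensor_sum[OF g_tensor tuples_pair, of Z Z 0 I \<psi> Y] by simp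

lemma g_nondegenerate:
  assumes X: "X \<in> V" and zero: "\<And>Y. Y \<in> V \<Longrightarrow> g [X, Y] = 0"
  shows "X = 0"
proof (rule vf_ext[OF X vector_fields_zero])
  fix \<psi> q assume "\<psi> \<in> C"
  then show "X \<psi> q = 0 \<psi> q" using g_pos[OF X, of \<psi> q] zero[OF X] by force
qed

text \<open>One Gram-Schmidt step near \<open>p\<close>: a coordinate field minus its components
  along \<open>e\<close>, normalised where the result is nonzero.\<close>

lemma orthonormal_extend:
  assumes e: "\<forall>i<m. e i \<in> V" and U: "open U" "p \<in> U"
    and orth: "\<forall>q\<in>U. \<forall>i<m. \<forall>j<m. g [e i, e j] q = (if i = j then 1 else 0)" and m: "m < DIM('e)"
  shows "\<exists>X U'. X \<in> V \<and> open U' \<and> p \<in> U' \<and> U' \<subseteq> U \<and>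
    (\<forall>q\<in>U'. g [X, X] q = 1 \<and> (\<forall>j<m. g [X, e j] q = 0))"
proof -
  obtain D x E where D0: "open D" "p \<in> D" "\<forall>b\<in>Basis. x b \<in> C" "\<forall>b\<in>Basis. E b \<in> V"
    "\<forall>X\<in>V. \<forall>\<psi>\<in>C. \<forall>q\<in>D. X \<psi> q = (\<Sum>b\<in>(Basis::'e set). X (x b) q * E b \<psi> q)"
    "\<forall>b\<in>Basis. \<forall>c\<in>Basis. \<forall>q\<in>D. E b (x c) q = (if b = c then 1 else 0)"
    by (rule coordinates[of p])
  note D = D0(1,2) D0(3,4,6)[rule_format]
  define P where "P b = (\<Sum>i<m. g [E b, e i] \<odot> e i)" for b
  have gC: "g [E b, e i] \<in> C" if "b \<in> Basis" "i < m" for b i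
    using that D(4) e by (intro tensor2_smooth g_tensor) auto
  have P: "P b \<in> V" if "b \<in> Basis" for b
    unfolding P_def using that gC e by (intro vector_fields_sum vector_fields_scale) auto
  have Z: "E b - P b \<in> V" if "b \<in> Basis" for b by (rule vector_fields_diff[OF D(4)[OF that] P[OF that]])
  \<comment> \<open>Otherwise every coordinate field would equal its projection at \<open>p\<close>,
    and all basis vectors would lie in the span of the \<open>m\<close> component vectors
    \<open>w i\<close>, contrary to \<open>m < DIM('e)\<close>.\<close>
  have "\<exists>b\<in>Basis. \<exists>\<psi>\<in>C. (E b - P b) \<psi> p \<noteq> 0"
  proof (rule ccontr)
    assume "\<not> ?thesis"
    then have eq: "E b \<psi> p = (\<Sum>i<m. g [E b, e i] p * e i \<psi> p)" if "b \<in> Basis" "\<psi> \<in> C" for b \<psi>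
      using that by (simp add: P_def fscale_def)
    define w where "w i = (\<Sum>c\<in>Basis. e i (x c) p *\<^sub>R c)" for i
    have "b \<in> span (w ` {..<m})" if b: "b \<in> Basis" for b
    proof -
      have "b = (\<Sum>c\<in>Basis. E b (x c) p *\<^sub>R c)"
        using b by (simp add: D(5) D(2) if_distrib[of "\<lambda>r. r *\<^sub>R _"] cong: if_cong)
      also have "\<dots> = (\<Sum>c\<in>Basis. \<Sum>i<m. g [E b, e i] p *\<^sub>R e i (x c) p *\<^sub>R c)"
        by (intro sum.cong refl) (simp add: eq[OF b D(3)] scaleR_sum_left)
      also have "\<dots> = (\<Sum>i<m. g [E b, e i] p *\<^sub>R w i)"
        unfolding w_def scaleR_sum_right by (rule sum.swap)
      also have "\<dots> \<in> span (w ` {..<m})"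
        by (intro span_sum span_scale span_base) auto
      finally show ?thesis .
    qed
    then have "span Basis \<subseteq> span (w ` {..<m})" by (intro span_minimal subspace_span) blast
    then have "dim (UNIV :: 'e set) \<le> card (w ` {..<m})" by (intro dim_le_card) auto
    also have "\<dots> \<le> m" using card_image_le[of "{..<m}" w] by simp
    finally show False using m by simp
  qed
  then obtain b \<psi> where b: "b \<in> Basis" and \<psi>: "\<psi> \<in> C" "(E b - P b) \<psi> p \<noteq> 0" by blast
  define Z where "Z = E b - P b"
  have ZV: "Z \<in> V" unfolding Z_def using Z[OF b] .
  have gZ: "g [Z, Z] \<in> C" by (rule tensor2_smooth[OF g_tensor ZV ZV])
  define W where "W = g [Z, Z] -` {0<..}"
  have cont: "continuous_on UNIV (g [Z, Z])" by (rule sm_on_continuous[OF open_UNIV sm_on_smooth[OF gZ]])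
  have W: "open W" unfolding W_def by (rule open_vimage[OF open_greaterThan cont])
  have pW: "p \<in> W" unfolding W_def using g_pos[OF ZV \<psi>(1)] \<psi>(2) Z_def by simp
  \<comment> \<open>The factor 1/|Z| is smooth only on \<open>W\<close>, where \<open>Z\<close> does
    not vanish; its germ at \<open>p\<close> is extended to a global function.\<close>
  have "sm_on W (\<lambda>q. g [Z, Z] q powr (-1/2))"
    by (rule sm_on_compose[OF W sm_on_smooth[OF gZ] _ smooth_on_powr]) (auto simp: W_def)
  then obtain u W' where u: "u \<in> C" "open W'" "p \<in> W'" "W' \<subseteq> W" "\<forall>q\<in>W'. u q = g [Z, Z] q powr (-1/2)"
    by (rule extension[OF W pW])
  have X: "u \<odot> Z \<in> V" using ZV u(1) by (rule vector_fields_scale)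
  have gX: "g [u \<odot> Z, Y] = u * g [Z, Y]" if "Y \<in> V" for Y by (rule g_scale_left[OF ZV that u(1)])
  have "g [u \<odot> Z, u \<odot> Z] q = 1" if "q \<in> W'" for q
  proof -
    have pos: "g [Z, Z] q > 0" using that u(4) by (auto simp: W_def)
    have "g [u \<odot> Z, u \<odot> Z] q = u q * u q * g [Z, Z] q"
      using gX[OF X] gX[OF ZV] g_sym[OF ZV X] by simp
    also have "u q * u q = g [Z, Z] q powr (-1)"
      using that u(5) by (simp add: powr_add[symmetric])
    finally show ?thesis using pos by (simp add: powr_minus)
  qed
  moreover have "g [u \<odot> Z, e j] q = 0" if "q \<in> U" "j < m" for q j
  proof -
    have ej: "e j \<in> V" using e that by blast
    have "g [P b, e j] = (\<Sum>i<m. g [E b, e i] * g [e i, e j])"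
      unfolding P_def using gC[OF b] e by (intro g_sum_left ej) auto
    then have "g [P b, e j] q = (\<Sum>i<m. g [E b, e i] q * (if i = j then 1 else 0))"
      using orth that by simp
    also have "\<dots> = g [E b, e j] q" using that by (simp add: if_distrib cong: if_cong)
    finally have "g [Z, e j] q = 0"
      unfolding Z_def using g_diff_left[OF D(4)[OF b] P[OF b] ej] by simp
    then show ?thesis using gX[OF ej] by simp
  qed
  ultimately show ?thesis using X u U by (intro exI[of _ "u \<odot> Z"] exI[of _ "U \<inter> W'"]) auto
qed

lemma orthonormal_near:
  "m \<le> DIM('e) \<Longrightarrow> \<exists>e U. (\<forall>i<m. e i \<in> V) \<and> open U \<and> p \<in> U \<and>
    (\<forall>q\<in>U. \<forall>i<m. \<forall>j<m. g [e i, e j] q = (if i = j then 1 else 0))"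
proof (induction m)
  case 0
  then show ?case by (intro exI[of _ "\<lambda>_. 0"] exI[of _ UNIV]) simp
next
  case (Suc m)
  then obtain e U where e: "\<forall>i<m. e i \<in> V" "open U" "p \<in> U"
    "\<forall>q\<in>U. \<forall>i<m. \<forall>j<m. g [e i, e j] q = (if i = j then 1 else 0)" by auto
  then obtain X U' where X: "X \<in> V" "open U'" "p \<in> U'" "U' \<subseteq> U"
    "\<forall>q\<in>U'. g [X, X] q = 1 \<and> (\<forall>j<m. g [X, e j] q = 0)"
    using orthonormal_extend[OF e] Suc.prems by auto
  have "g [(e(m := X)) i, (e(m := X)) j] q = (if i = j then 1 else 0)"
    if "q \<in> U'" "i < Suc m" "j < Suc m" for q i j
    using that e(4) X(4,5) g_sym[OF X(1)] e(1) by (auto simp: less_Suc_eq)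
  then show ?case using e(1) X(1-3)
    by (intro exI[of _ "e(m := X)"] exI[of _ U']) (auto simp: less_Suc_eq)
qed

lemma orthonormal_frame_near_frame: "orthonormal_frame_near A g p (frame A g p)"
proof -
  obtain e U where "\<forall>i<DIM('e). e i \<in> V" "open U" "p \<in> U"
    "\<forall>q\<in>U. \<forall>i<DIM('e). \<forall>j<DIM('e). g [e i, e j] q = (if i = j then 1 else 0)"
    using orthonormal_near[OF order_refl, of p] by blast
  then have "orthonormal_frame_near A g p e" unfolding orthonormal_frame_near_def by blast
  then show ?thesis unfolding frame_def by (rule someI[where P = "orthonormal_frame_near A g p"])
qed

lemma frame_vf: "i < DIM('e) \<Longrightarrow> frame A g p i \<in> V"
  using orthonormal_frame_near_frame[of p] unfolding orthonormal_frame_near_def by blast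

text \<open>A condition at a single point, so that at \<open>q\<close> the frame chosen at
  \<open>q\<close> can be compared with one chosen at a nearby \<open>p\<close>.\<close>

definition orthonormal_at :: "'m \<Rightarrow> (nat \<Rightarrow> 'm vfield) \<Rightarrow> bool" where
  "orthonormal_at q e \<longleftrightarrow> (\<forall>i<DIM('e). e i \<in> V) \<and>
    (\<forall>i<DIM('e). \<forall>j<DIM('e). g [e i, e j] q = (if i = j then 1 else 0))"

lemma frame_near:
  obtains U where "open U" "p \<in> U" "\<forall>q\<in>U. orthonormal_at q (frame A g p)"
  using orthonormal_frame_near_frame[of p] unfolding orthonormal_frame_near_def orthonormal_at_def by blast

lemma orthonormal_at_frame: "orthonormal_at p (frame A g p)"
  by (rule frame_near[of p]) blast

text \<open>\<open>DIM('e)\<close> orthonormal vectors at \<open>q\<close> are linearly independent,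
  hence they span: by \<open>coordinates\<close>, a derivation has at \<open>q\<close> only
  \<open>DIM('e)\<close> degrees of freedom.\<close>

lemma orthonormal_expansion:
  assumes o: "orthonormal_at q e" and Y: "Y \<in> V" and \<psi>: "\<psi> \<in> C"
  shows "Y \<psi> q = (\<Sum>i<DIM('e). g [Y, e i] q * e i \<psi> q)"
proof -
  obtain D x E where D: "open D" "q \<in> D" "\<And>b. b \<in> Basis \<Longrightarrow> x b \<in> C" "\<And>b. b \<in> Basis \<Longrightarrow> E b \<in> V"
    "\<And>X \<psi> r. X \<in> V \<Longrightarrow> \<psi> \<in> C \<Longrightarrow> r \<in> D \<Longrightarrow> X \<psi> r = (\<Sum>b\<in>(Basis::'e set). X (x b) r * E b \<psi> r)"
    by (rule coordinates[of q]) blast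
  have eV: "e i \<in> V" if "i < DIM('e)" for i using o that by (auto simp: orthonormal_at_def)
  \<comment> \<open>\<open>w X\<close> is the vector of components of \<open>X\<close> at
    \<open>q\<close>; by the coordinate expansion it determines every value
    \<open>X \<psi> q\<close>.\<close>
  define w where "w X = (\<Sum>c\<in>Basis. X (x c) q *\<^sub>R c)" for X
  have w: "w X \<bullet> c = X (x c) q" if "c \<in> Basis" for X c
    using that by (simp add: w_def inner_sum_left inner_Basis if_distrib cong: if_cong)
  obtain bs where bs: "bij_betw bs {..<DIM('e)} (Basis::'e set)"
    using ex_bij_betw_nat_finite[OF finite_Basis] by (auto simp: lessThan_atLeast0)
  \<comment> \<open>\<open>F v\<close> has constant coefficients with respect to \<open>e\<close>,
    and orthonormality recovers them at \<open>q\<close>. So the linear map from \<open>v\<close> to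
    \<open>w (F v)\<close> is injective, hence onto, and \<open>Y\<close> agrees at \<open>q\<close>
    with some \<open>F v\<close>.\<close>
  define F where "F v = (\<Sum>i<DIM('e). (\<lambda>_. v \<bullet> bs i) \<odot> e i)" for v
  have F: "F v \<in> V" for v unfolding F_def by (intro vector_fields_sum vector_fields_scale eV smooth_const) simp
  have F_at: "F v \<xi> q = (\<Sum>i<DIM('e). (v \<bullet> bs i) * e i \<xi> q)" for v \<xi>
    by (simp add: F_def fscale_def)
  have gF: "g [F v, e j] q = v \<bullet> bs j" if j: "j < DIM('e)" for v j
  proof -
    have "g [F v, e j] = (\<Sum>i<DIM('e). (\<lambda>_. v \<bullet> bs i) * g [e i, e j])"
      unfolding F_def by (intro g_sum_left eV j smooth_const) simp
    then have "g [F v, e j] q = (\<Sum>i<DIM('e). (v \<bullet> bs i) * g [e i, e j] q)" by simp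
    also have "\<dots> = (\<Sum>i<DIM('e). (v \<bullet> bs i) * (if i = j then 1 else 0))"
      using o j by (intro sum.cong) (auto simp: orthonormal_at_def)
    also have "\<dots> = v \<bullet> bs j" using j by (simp add: if_distrib cong: if_cong)
    finally show ?thesis .
  qed
  have eq_at: "X \<xi> q = Z \<xi> q" if "X \<in> V" "Z \<in> V" "w X = w Z" "\<xi> \<in> C" for X Z \<xi>
  proof -
    have "X (x b) q = Z (x b) q" if "b \<in> Basis" for b using w[OF that] \<open>w X = w Z\<close> by metis
    then show ?thesis using D(5)[OF that(1,4) D(2)] D(5)[OF that(2,4) D(2)] by simp
  qed
  have g_eq: "g [X, Z] q = g [X', Z] q" if "X \<in> V" "X' \<in> V" "Z \<in> V" "w X = w X'" for X X' Z
    using tensor_eq_at[OF g_tensor tuples_pair[OF that(1,3)], of 0 X X' q] eq_at that by simp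
  have lin: "linear (\<lambda>v. w (F v))"
    by (rule linearI) (simp_all add: w_def F_at inner_add_left distrib_right sum.distrib scaleR_left_distrib
        scaleR_sum_right sum_distrib_left[symmetric] mult.assoc)
  moreover have "inj (\<lambda>v. w (F v))"
  proof (subst linear_injective_0[OF lin], intro allI impI)
    fix v assume "w (F v) = 0"
    then have "w (F v) = w (F 0)" using linear_0[OF lin] by simp
    then have "v \<bullet> bs j = 0" if "j < DIM('e)" for j
      using g_eq[OF F[of v] F[of 0] eV[OF that]] gF[OF that] by simp
    then have "v \<bullet> b = 0" if "b \<in> Basis" for b
      using bs that unfolding bij_betw_def by (metis imageE lessThan_iff)
    then show "v = 0" by (simp add: euclidean_eq_iff[of v 0])
  qed
  ultimately have "surj (\<lambda>v. w (F v))" by (rule linear_injective_imp_surjective) simp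
  then obtain v where v: "w Y = w (F v)" by (metis surjD)
  have "g [Y, e j] q = v \<bullet> bs j" if "j < DIM('e)" for j
    using g_eq[OF Y F eV[OF that] v] gF[OF that] by simp
  moreover have "Y \<psi> q = F v \<psi> q" by (rule eq_at[OF Y F v \<psi>])
  ultimately show ?thesis by (simp add: F_at)
qed

section \<open>Metric traces and their derivatives\<close>

context
  fixes S q e
  assumes S: "S \<in> tensors A 2" and o: "orthonormal_at q e"
begin

lemma tensor_expand:
  assumes Xs: "Xs \<in> tuples A 2" and i: "i < 2" and Y: "Y \<in> V"
  shows "S (Xs[i := Y]) q = (\<Sum>j<DIM('e). g [Y, e j] q * S (Xs[i := e j]) q)"
proof -
  have eV: "e j \<in> V" if "j < DIM('e)" for j using o that by (auto simp: orthonormal_at_def)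
  have gC: "g [Y, e j] \<in> C" if "j < DIM('e)" for j by (rule tensor2_smooth[OF g_tensor Y eV[OF that]])
  have F: "(\<Sum>j<DIM('e). g [Y, e j] \<odot> e j) \<in> V"
    using eV gC by (intro vector_fields_sum vector_fields_scale) auto
  have "S (Xs[i := Y]) q = S (Xs[i := \<Sum>j<DIM('e). g [Y, e j] \<odot> e j]) q"
    by (rule tensor_eq_at[OF S Xs i Y F]) (simp add: fscale_def orthonormal_expansion[OF o Y])
  also have "\<dots> = (\<Sum>j<DIM('e). g [Y, e j] * S (Xs[i := e j])) q"
    by (subst tensor_sum[OF S Xs i]) (use eV gC in auto)
  finally show ?thesis by simp
qed

lemma tensor_expand_left: "Y \<in> V \<Longrightarrow> Z \<in> V \<Longrightarrow> S [Y, Z] q = (\<Sum>j<DIM('e). g [Y, e j] q * S [e j, Z] q)"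
  using tensor_expand[OF tuples_pair, of Y Z 0 Y] by simp

lemma tensor_expand_right: "Y \<in> V \<Longrightarrow> Z \<in> V \<Longrightarrow> S [Z, Y] q = (\<Sum>j<DIM('e). g [Y, e j] q * S [Z, e j] q)"
  using tensor_expand[OF tuples_pair, of Z Y 1 Y] by simp

end

text \<open>Both traces equal the double sum of \<open>g [e i, e' j] q * S [e i, e' j] q\<close>:
  expand the second slot in \<open>e'\<close>, or the first slot in \<open>e\<close>.\<close>

lemma metric_trace_frame_independent:
  assumes S: "S \<in> tensors A 2" and e: "orthonormal_at q e" and e': "orthonormal_at q e'"
  shows "(\<Sum>i<DIM('e). S [e i, e i] q) = (\<Sum>i<DIM('e). S [e' i, e' i] q)"
proof -
  have V: "e i \<in> V" "e' i \<in> V" if "i < DIM('e)" for i using e e' that by (auto simp: orthonormal_at_def)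
  have "(\<Sum>i<DIM('e). S [e i, e i] q) = (\<Sum>i<DIM('e). \<Sum>j<DIM('e). g [e i, e' j] q * S [e i, e' j] q)"
    using tensor_expand_right[OF S e'] V by simp
  also have "\<dots> = (\<Sum>j<DIM('e). \<Sum>i<DIM('e). g [e i, e' j] q * S [e i, e' j] q)"
    by (rule sum.swap)
  also have "\<dots> = (\<Sum>j<DIM('e). \<Sum>i<DIM('e). g [e' j, e i] q * S [e i, e' j] q)"
    using V g_sym by simp
  also have "\<dots> = (\<Sum>j<DIM('e). S [e' j, e' j] q)"
    using tensor_expand_left[OF S e] V by simp
  finally show ?thesis .
qed

text \<open>The frame is chosen anew at every point, so smoothness in \<open>p\<close> cannot be
  read off from this expression; it comes from \<open>metric_trace_near\<close>.\<close>

definition metric_trace :: "'m tensor \<Rightarrow> 'm \<Rightarrow> real" where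
  "metric_trace S p = (\<Sum>i<DIM('e). S [frame A g p i, frame A g p i] p)"

lemma metric_trace_near:
  assumes S: "S \<in> tensors A 2"
  obtains U where "open U" "p \<in> U"
    "\<forall>q\<in>U. metric_trace S q = (\<Sum>i<DIM('e). S [frame A g p i, frame A g p i]) q"
proof -
  obtain U where U: "open U" "p \<in> U" "\<forall>q\<in>U. orthonormal_at q (frame A g p)" by (rule frame_near)
  show ?thesis
    by (rule that[OF U(1,2)]) (use U(3) metric_trace_frame_independent[OF S orthonormal_at_frame] in \<open>simp add: metric_trace_def\<close>)
qed

lemma metric_trace_smooth: assumes S: "S \<in> tensors A 2" shows "metric_trace S \<in> C"
proof (rule smooth_functionsI_local)
  fix p
  obtain U where U: "open U" "p \<in> U"
    "\<forall>q\<in>U. metric_trace S q = (\<Sum>i<DIM('e). S [frame A g p i, frame A g p i]) q" by (rule metric_trace_near[OF S])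
  have "(\<Sum>i<DIM('e). S [frame A g p i, frame A g p i]) \<in> C"
    by (intro smooth_sum tensor2_smooth[OF S] frame_vf) auto
  then have "sm_on U (metric_trace S)"
    by (intro sm_on_cong[OF U(1) _ sm_on_smooth]) (use U(3) in auto)
  then show "\<exists>W. open W \<and> p \<in> W \<and> sm_on W (metric_trace S)" using U by blast
qed

text \<open>Expand \<open>L (e i)\<close> in the frame: both sums run over
  \<open>S [e i, e j] p\<close>, with coefficients that are transposed to each other and so cancel
  by skewness. Skewness is required at \<open>p\<close> and on the frame only.\<close>

lemma metric_trace_skew:
  assumes S: "S \<in> tensors A 2" and e: "orthonormal_at p e" and L: "\<And>Y. Y \<in> V \<Longrightarrow> L Y \<in> V"
    and skew: "\<And>i j. i < DIM('e) \<Longrightarrow> j < DIM('e) \<Longrightarrow> g [L (e i), e j] p + g [e i, L (e j)] p = 0"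
  shows "(\<Sum>i<DIM('e). S [L (e i), e i] p + S [e i, L (e i)] p) = 0"
proof -
  have eV: "e i \<in> V" if "i < DIM('e)" for i using e that by (auto simp: orthonormal_at_def)
  have "(\<Sum>i<DIM('e). S [e i, L (e i)] p) = (\<Sum>i<DIM('e). \<Sum>j<DIM('e). g [L (e i), e j] p * S [e i, e j] p)"
    using tensor_expand_right[OF S e] eV L by simp
  also have "\<dots> = (\<Sum>j<DIM('e). \<Sum>i<DIM('e). g [L (e i), e j] p * S [e i, e j] p)" by (rule sum.swap)
  also have "\<dots> = (\<Sum>j<DIM('e). \<Sum>i<DIM('e). - (g [L (e j), e i] p * S [e i, e j] p))"
  proof (intro sum.cong refl)
    fix i j assume "j \<in> {..<DIM('e)}" "i \<in> {..<DIM('e)}"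
    then have "g [L (e i), e j] p = - g [L (e j), e i] p"
      using skew[of i j] g_sym[of "e i" "L (e j)"] eV L by simp
    then show "g [L (e i), e j] p * S [e i, e j] p = - (g [L (e j), e i] p * S [e i, e j] p)" by simp
  qed
  also have "\<dots> = - (\<Sum>j<DIM('e). S [L (e j), e j] p)"
    using tensor_expand_left[OF S e] eV L by (simp add: sum_negf)
  finally show ?thesis by (simp add: sum.distrib)
qed

text \<open>In the frame frozen at \<open>p\<close> the derivative of the trace is the sum of the
  plain derivatives; the terms with \<open>L\<close>, which turn them into covariant ones, add up to
  0 by \<open>metric_trace_skew\<close>. In the application \<open>Z\<close> is \<open>f X\<close>
  and \<open>L\<close> is \<open>N X\<close>.\<close>

lemma vf_metric_trace:
  assumes S: "S \<in> tensors A 2" and Z: "Z \<in> V" and L: "\<And>Y. Y \<in> V \<Longrightarrow> L Y \<in> V"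
    and metric: "\<And>Y W. Y \<in> V \<Longrightarrow> W \<in> V \<Longrightarrow> Z (g [Y, W]) = g [L Y, W] + g [Y, L W]"
  defines "e \<equiv> frame A g"
  shows "Z (metric_trace S) p = (\<Sum>i<DIM('e). (Z (S [e p i, e p i]) - S [L (e p i), e p i] - S [e p i, L (e p i)]) p)"
proof -
  obtain U where U: "open U" "p \<in> U" "\<forall>q\<in>U. metric_trace S q = (\<Sum>i<DIM('e). S [e p i, e p i]) q"
    unfolding e_def by (rule metric_trace_near[OF S])
  obtain U' where U': "open U'" "p \<in> U'" "\<forall>q\<in>U'. orthonormal_at q (e p)"
    unfolding e_def by (rule frame_near)
  have eV: "e p i \<in> V" if "i < DIM('e)" for i unfolding e_def using that by (rule frame_vf)
  have SC: "S [e p i, e p i] \<in> C" if "i < DIM('e)" for i by (rule tensor2_smooth[OF S eV[OF that] eV[OF that]])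
  have "Z (metric_trace S) p = Z (\<Sum>i<DIM('e). S [e p i, e p i]) p"
    by (rule vf_local[OF Z U(1,2) metric_trace_smooth[OF S] smooth_sum]) (use SC U(3) in auto)
  also have "\<dots> = (\<Sum>i<DIM('e). Z (S [e p i, e p i]) p)"
    by (subst vf_sum[OF Z]) (use SC in auto)
  finally have 1: "Z (metric_trace S) p = (\<Sum>i<DIM('e). Z (S [e p i, e p i]) p)" .
  have "g [L (e p i), e p j] p + g [e p i, L (e p j)] p = 0" if "i < DIM('e)" "j < DIM('e)" for i j
  proof -
    \<comment> \<open>Orthonormality on a whole neighbourhood enters here: the inner products are
      constant near \<open>p\<close>, so their derivative vanishes and \<open>metric\<close> yields
      skewness of \<open>L\<close> on the frame.\<close>
    have "Z (g [e p i, e p j]) p = Z (\<lambda>_. if i = j then 1 else 0) p"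
      by (rule vf_local[OF Z U'(1,2) tensor2_smooth[OF g_tensor eV[OF that(1)] eV[OF that(2)]] smooth_const])
        (use U'(3) that in \<open>auto simp: orthonormal_at_def\<close>)
    then show ?thesis using metric[OF eV[OF that(1)] eV[OF that(2)]] vf_const[OF Z] by simp
  qed
  from metric_trace_skew[where e = "e p" and L = L and p = p, OF S _ L this] U'(2,3)
  have "(\<Sum>i<DIM('e). S [L (e p i), e p i] p + S [e p i, L (e p i)] p) = 0" by blast
  then show ?thesis unfolding 1 by (simp add: sum_subtractf sum.distrib algebra_simps)
qed

end

section \<open>Metric \<open>f\<close>-connections and the Weitzenboeck formula\<close>

text \<open>The sign in \<open>ext_f_derivative\<close> is a power in the ring of functions; as a
  constant function it can be moved through a derivation.\<close>

lemma minus_one_power_fun: "(- 1) ^ j = (\<lambda>_::'a. (- 1) ^ j :: real)"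
  by (induction j) (simp_all add: fun_eq_iff)

abbreviation move_front :: "nat \<Rightarrow> 'a list \<Rightarrow> 'a list" where
  "move_front j Xs \<equiv> Xs ! j # take j Xs @ drop (Suc j) Xs"

text \<open>\<open>s\<close> is the position in the rearranged list of the entry that stood at
  \<open>l\<close>.\<close>

lemma move_front_update:
  assumes "j < length Xs" "l < length Xs"
  defines "s \<equiv> (if l = j then 0 else if l < j then Suc l else l)"
  shows "move_front j (Xs[l := Z]) = (move_front j Xs)[s := Z]" and "move_front j Xs ! s = Xs ! l"
proof -
  consider "l = j" | "l < j" | m where "l = Suc m" "j \<le> m"
    by (metis Suc_le_D Suc_le_mono linorder_neqE_nat less_eq_Suc_le)
  then have "move_front j (Xs[l := Z]) = (move_front j Xs)[s := Z] \<and> move_front j Xs ! s = Xs ! l"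
  proof cases
    case 1 then show ?thesis using assms(1) by (simp add: s_def)
  next
    case 2 then show ?thesis using assms(1,2)
      by (simp add: s_def take_update_swap list_update_append nth_append)
  next
    case 3 then show ?thesis using assms(1,2)
      by (simp add: s_def drop_update_swap list_update_append nth_append min_absorb2)
  qed
  then show "move_front j (Xs[l := Z]) = (move_front j Xs)[s := Z]" "move_front j Xs ! s = Xs ! l" by auto
qed

text \<open>Moving an entry to the front permutes the positions, so summing over the position where
  \<open>F\<close> acts gives the same total before and after.\<close>

lemma sum_move_front:
  assumes j: "j < length Xs"
  shows "(\<Sum>l<length Xs. h (move_front j (Xs[l := F (Xs ! l)])))
    = (\<Sum>l<length Xs. h ((move_front j Xs)[l := F (move_front j Xs ! l)]))"
proof -
  define s where "s l = (if l = j then 0 else if l < j then Suc l else l)" for l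
  define t where "t l = (if l = 0 then j else if l \<le> j then l - 1 else l)" for l
  have bij: "bij_betw s {..<length Xs} {..<length Xs}"
    by (rule bij_betw_byWitness[where f' = t]) (use j in \<open>auto simp: s_def t_def\<close>)
  have "(\<Sum>l<length Xs. h (move_front j (Xs[l := F (Xs ! l)])))
    = (\<Sum>l<length Xs. h ((move_front j Xs)[s l := F (move_front j Xs ! s l)]))"
    using move_front_update[OF j] by (intro sum.cong refl arg_cong[of _ _ h]) (auto simp: s_def)
  also have "\<dots> = (\<Sum>l<length Xs. h ((move_front j Xs)[l := F (move_front j Xs ! l)]))"
    by (rule sum.reindex_bij_betw[OF bij])
  finally show ?thesis .
qed

text \<open>Differentiating the first slot contributes \<open>cov a N (N Y Z) S Xs\<close>, exactly
  the correction subtracted in \<open>second_cov\<close>.\<close>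

lemma cov_total_cov: "cov a N Y (total_cov a N S) (Z # Xs) = second_cov a N Y Z S Xs"
  unfolding cov_def[of a N Y "total_cov a N S"]
  by (simp add: second_cov_def cov_def[of a N Y "cov a N Z S"] total_cov_def sum.lessThan_Suc_shift
      del: sum.lessThan_Suc plus_fun_apply sum_fun_apply)

context manifold
begin

section \<open>Alternating tensors\<close>

lemma forms_tensor: "\<omega> \<in> forms A k \<Longrightarrow> \<omega> \<in> tensors A k"
  unfolding forms_def by auto

lemma forms_alternating:
  "\<omega> \<in> forms A k \<Longrightarrow> Xs \<in> tuples A k \<Longrightarrow> i < k \<Longrightarrow> j < k \<Longrightarrow> i \<noteq> j \<Longrightarrow> Xs ! i = Xs ! j \<Longrightarrow> \<omega> Xs = 0"
  unfolding forms_def by (metis (mono_tags, lifting) linorder_neqE_nat mem_Collect_eq)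

lemma formsI:
  assumes "\<omega> \<in> tensors A k"
    "\<And>Xs i j. Xs \<in> tuples A k \<Longrightarrow> i < j \<Longrightarrow> j < k \<Longrightarrow> Xs ! i = Xs ! j \<Longrightarrow> \<omega> Xs = 0"
  shows "\<omega> \<in> forms A k"
  unfolding forms_def using assms by auto

text \<open>Polarisation: expand the vanishing value with \<open>Z + W\<close> in both
  slots.\<close>

lemma forms_swap:
  assumes \<omega>: "\<omega> \<in> forms A k" and Xs: "Xs \<in> tuples A k" and ij: "i < k" "j < k" "i \<noteq> j"
    and Z: "Z \<in> V" and W: "W \<in> V"
  shows "\<omega> (Xs[i := Z, j := W]) = - \<omega> (Xs[i := W, j := Z])"
proof -
  note S = forms_tensor[OF \<omega>]
  have u: "Xs[i := Y] \<in> tuples A k" "Xs[i := Y, j := Y'] \<in> tuples A k" if "Y \<in> V" "Y' \<in> V" for Y Y'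
    using tuples_update Xs that by auto
  have alt: "\<omega> (Xs[i := Y, j := Y]) = 0" if "Y \<in> V" for Y
    by (rule forms_alternating[OF \<omega> u(2)[OF that that] ij])
      (use ij tuples_length[OF Xs] in \<open>simp add: nth_list_update\<close>)
  have add1: "\<omega> (Xs[i := Z + W, j := Y]) = \<omega> (Xs[i := Z, j := Y]) + \<omega> (Xs[i := W, j := Y])" if "Y \<in> V" for Y
    unfolding list_update_swap[OF ij(3)] by (rule tensor_add[OF S tuples_update[OF Xs that, of j] ij(1) Z W])
  have ZW: "Z + W \<in> V" by (rule vector_fields_add[OF Z W])
  have "0 = \<omega> (Xs[i := Z + W, j := Z + W])" using alt[OF ZW] by simp
  also have "\<dots> = \<omega> (Xs[i := Z + W, j := Z]) + \<omega> (Xs[i := Z + W, j := W])"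
    by (rule tensor_add[OF S u(1)[OF ZW ZW] ij(2) Z W])
  also have "\<dots> = \<omega> (Xs[i := W, j := Z]) + \<omega> (Xs[i := Z, j := W])"
    using add1[OF Z] add1[OF W] alt[OF Z] alt[OF W] by (simp only: add_0_left add_0_right)
  finally show ?thesis by (metis add.commute add_eq_0_iff)
qed

text \<open>\<open>Y\<close> travels from the front to slot \<open>a\<close> by \<open>a\<close>
  transpositions of neighbours, each of which costs a sign.\<close>

lemma forms_move_front:
  assumes \<omega>: "\<omega> \<in> forms A k" and Y: "Y \<in> V"
  shows "Xs \<in> tuples A k \<Longrightarrow> a < k \<Longrightarrow>
    \<omega> (Y # take a Xs @ drop (Suc a) Xs) p = (- 1) ^ a * \<omega> (Xs[a := Y]) p"
proof (induction a arbitrary: Xs)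
  case 0
  then have "Xs[0 := Y] = Y # drop (Suc 0) Xs" using tuples_length[OF 0(1)] by (cases Xs) auto
  then show ?case by simp
next
  case (Suc a)
  note len = tuples_length[OF Suc.prems(1)]
  have Xa: "Xs ! a \<in> V" using tuples_nth[OF Suc.prems(1), of a] Suc.prems(2) by simp
  \<comment> \<open>Deleting position \<open>a\<close> from \<open>Zs\<close> gives the same list as
    deleting position \<open>Suc a\<close> from \<open>Xs\<close>, so the induction hypothesis
    applies to \<open>Zs\<close>.\<close>
  define Zs where "Zs = Xs[Suc a := Xs ! a]"
  have "take a Zs @ drop (Suc a) Zs = take (Suc a) Xs @ drop (Suc (Suc a)) Xs"
    using Suc.prems(2) len
    by (simp add: Zs_def take_Suc_conv_app_nth Cons_nth_drop_Suc[symmetric])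
  then have "\<omega> (Y # take (Suc a) Xs @ drop (Suc (Suc a)) Xs) p = (- 1) ^ a * \<omega> (Zs[a := Y]) p"
    using Suc.IH[of Zs] Suc.prems tuples_update[OF Suc.prems(1) Xa] by (simp add: Zs_def)
  also have "\<omega> (Zs[a := Y]) = - \<omega> (Xs[Suc a := Y, a := Xs ! a])"
    unfolding Zs_def by (rule forms_swap[OF \<omega> Suc.prems(1,2) _ _ Xa Y]) (use Suc.prems in auto)
  also have "Xs[Suc a := Y, a := Xs ! a] = Xs[Suc a := Y]"
    by (subst list_update_swap) simp_all
  finally show ?case by simp
qed

lemma tensors_diff:
  assumes "S \<in> tensors A k" "T \<in> tensors A k"
  shows "S - T \<in> tensors A k"
  by (rule tensorsI)
    (use assms in \<open>simp_all add: smooth_diff tensor_smooth tensor_add tensor_scale algebra_simps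
      del: plus_fun_apply times_fun_apply\<close>)

lemma forms_diff:
  assumes "S \<in> forms A k" "T \<in> forms A k"
  shows "S - T \<in> forms A k"
proof (rule formsI)
  show "S - T \<in> tensors A k" using assms by (intro tensors_diff forms_tensor)
  fix Xs i j assume "Xs \<in> tuples A k" "i < j" "j < k" "Xs ! i = Xs ! j"
  then have "S Xs = 0" "T Xs = 0"
    using forms_alternating[OF assms(1), of Xs i j] forms_alternating[OF assms(2), of Xs i j] by auto
  then show "(S - T) Xs = 0" by simp
qed

end

text \<open>\<open>N'\<close> need only agree with \<open>N\<close> on vector fields: the metric adjoint in the dual connection
  is undetermined elsewhere.\<close>

locale metric_f_connection = riemannian A g
  for A :: "('m::{t2_space,second_countable_topology}, 'e::euclidean_space) atlas" and g :: "'m tensor" +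
  fixes f :: "'m vfield \<Rightarrow> 'm vfield" and N N' :: "'m connection"
  assumes f_endomorphism: "f \<in> endomorphisms A"
    and N_vf: "X \<in> V \<Longrightarrow> Y \<in> V \<Longrightarrow> N X Y \<in> V"
    and N_add_left: "X \<in> V \<Longrightarrow> Y \<in> V \<Longrightarrow> Z \<in> V \<Longrightarrow> N (X + Y) Z = N X Z + N Y Z"
    and N_scale_left: "X \<in> V \<Longrightarrow> Y \<in> V \<Longrightarrow> \<psi> \<in> C \<Longrightarrow> N (\<psi> \<odot> X) Y = \<psi> \<odot> N X Y"
    and N_add_right: "X \<in> V \<Longrightarrow> Y \<in> V \<Longrightarrow> Z \<in> V \<Longrightarrow> N X (Y + Z) = N X Y + N X Z"
    and N_scale_right: "X \<in> V \<Longrightarrow> Y \<in> V \<Longrightarrow> \<psi> \<in> C \<Longrightarrow> N X (\<psi> \<odot> Y) = f X \<psi> \<odot> Y + \<psi> \<odot> N X Y"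
    and N_metric: "X \<in> V \<Longrightarrow> Y \<in> V \<Longrightarrow> Z \<in> V \<Longrightarrow> f X (g [Y, Z]) = g [N X Y, Z] + g [Y, N X Z]"
    and N'_eq: "X \<in> V \<Longrightarrow> Y \<in> V \<Longrightarrow> N' X Y = N X Y"
begin

lemma f_vf: "X \<in> V \<Longrightarrow> f X \<in> V"
  and f_add: "X \<in> V \<Longrightarrow> Y \<in> V \<Longrightarrow> f (X + Y) = f X + f Y"
  and f_scale: "X \<in> V \<Longrightarrow> \<psi> \<in> C \<Longrightarrow> f (\<psi> \<odot> X) = \<psi> \<odot> f X"
  using f_endomorphism unfolding endomorphisms_def by auto

lemma cov_tuple: "Xs \<in> tuples A k \<Longrightarrow> cov f N Y S Xs = f Y (S Xs) - (\<Sum>l<k. S (Xs[l := N Y (Xs ! l)]))"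
  by (simp only: cov_def tuples_length)

lemma cov_dual:
  assumes Xs: "Xs \<in> tuples A k" and Y: "Y \<in> V"
  shows "cov f N' Y S Xs = cov f N Y S Xs"
proof -
  have "(\<Sum>l<k. S (Xs[l := N' Y (Xs ! l)])) = (\<Sum>l<k. S (Xs[l := N Y (Xs ! l)]))"
    by (rule sum.cong) (simp_all add: N'_eq[OF Y tuples_nth[OF Xs]])
  then show ?thesis by (simp only: cov_def tuples_length[OF Xs])
qed

section \<open>Covariant differentiation preserves tensors and forms\<close>

context
  fixes S k Y
  assumes S: "S \<in> tensors A k" and Y: "Y \<in> V"
begin

lemma cov_smooth: assumes Xs: "Xs \<in> tuples A k" shows "cov f N Y S Xs \<in> C"
  unfolding cov_tuple[OF Xs]
  by (intro smooth_diff smooth_sum vf_smooth[OF f_vf[OF Y]] tensor_smooth[OF S] tuples_update N_vf Y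
      tuples_nth[OF Xs] Xs) auto

lemma cov_add:
  assumes Xs: "Xs \<in> tuples A k" and i: "i < k" and Z: "Z \<in> V" and W: "W \<in> V"
  shows "cov f N Y S (Xs[i := Z + W]) = cov f N Y S (Xs[i := Z]) + cov f N Y S (Xs[i := W])"
proof -
  note len = tuples_length[OF Xs]
  note u = tuples_update[OF Xs]
  have ZW: "Z + W \<in> V" by (rule vector_fields_add[OF Z W])
  define T where "T l Q = S (Xs[i := Q, l := N Y (Xs[i := Q] ! l)])" for l Q
  have "T l (Z + W) = T l Z + T l W" if l: "l < k" for l
  proof (cases "l = i")
    case True
    then show ?thesis using tensor_add[OF S Xs i N_vf[OF Y Z] N_vf[OF Y W]] i len
      by (simp only: T_def list_update_overwrite nth_list_update_eq N_add_right[OF Y Z W])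
  next
    case False
    have NV: "N Y (Xs ! l) \<in> V" by (rule N_vf[OF Y tuples_nth[OF Xs l]])
    have "T l Q = S (Xs[l := N Y (Xs ! l), i := Q])" for Q
      using False by (simp add: T_def list_update_swap[of i l])
    then show ?thesis using tensor_add[OF S u[OF NV] i Z W] by simp
  qed
  then have "(\<Sum>l<k. T l (Z + W)) = (\<Sum>l<k. T l Z) + (\<Sum>l<k. T l W)"
    by (simp add: sum.distrib[symmetric] del: plus_fun_apply sum_fun_apply)
  moreover have "f Y (S (Xs[i := Z + W])) = f Y (S (Xs[i := Z])) + f Y (S (Xs[i := W]))"
    unfolding tensor_add[OF S Xs i Z W]
    by (rule vf_plus[OF f_vf[OF Y] tensor_smooth[OF S u[OF Z]] tensor_smooth[OF S u[OF W]]])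
  ultimately show ?thesis
    unfolding cov_tuple[OF u[OF ZW]] cov_tuple[OF u[OF Z]] cov_tuple[OF u[OF W]] T_def by (simp only: algebra_simps)
qed

text \<open>Differentiating the value produces \<open>R = f Y \<psi> * S (Xs[i := Z])\<close>, and
  the Leibniz rule of \<open>N\<close> in slot \<open>i\<close> produces it again with the opposite
  sign. For this the action on functions and \<open>N_scale_right\<close> must use the same field
  \<open>f Y\<close>.\<close>

lemma cov_scale:
  assumes Xs: "Xs \<in> tuples A k" and i: "i < k" and Z: "Z \<in> V" and \<psi>: "\<psi> \<in> C"
  shows "cov f N Y S (Xs[i := \<psi> \<odot> Z]) = \<psi> * cov f N Y S (Xs[i := Z])"
proof -
  note len = tuples_length[OF Xs]
  note u = tuples_update[OF Xs]
  have pZ: "\<psi> \<odot> Z \<in> V" by (rule vector_fields_scale[OF Z \<psi>])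
  have fC: "f Y \<psi> \<in> C" by (rule vf_smooth[OF f_vf[OF Y] \<psi>])
  define R where "R = f Y \<psi> * S (Xs[i := Z])"
  define T where "T l Q = S (Xs[i := Q, l := N Y (Xs[i := Q] ! l)])" for l Q
  have "T l (\<psi> \<odot> Z) = \<psi> * T l Z + (if l = i then R else 0)" if l: "l < k" for l
  proof (cases "l = i")
    case True
    have NZ: "N Y Z \<in> V" by (rule N_vf[OF Y Z])
    have "T l (\<psi> \<odot> Z) = S (Xs[i := f Y \<psi> \<odot> Z + \<psi> \<odot> N Y Z])"
      using True i len by (simp only: T_def list_update_overwrite nth_list_update_eq N_scale_right[OF Y Z \<psi>])
    also have "\<dots> = R + \<psi> * S (Xs[i := N Y Z])"
      unfolding R_def tensor_add[OF S Xs i vector_fields_scale[OF Z fC] vector_fields_scale[OF NZ \<psi>]]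
        tensor_scale[OF S Xs i Z fC] tensor_scale[OF S Xs i NZ \<psi>] ..
    also have "S (Xs[i := N Y Z]) = T l Z"
      using True i len by (simp only: T_def list_update_overwrite nth_list_update_eq)
    finally show ?thesis using True by (simp add: add.commute del: plus_fun_apply times_fun_apply)
  next
    case False
    have NV: "N Y (Xs ! l) \<in> V" by (rule N_vf[OF Y tuples_nth[OF Xs l]])
    have "T l Q = S (Xs[l := N Y (Xs ! l), i := Q])" for Q
      using False by (simp add: T_def list_update_swap[of i l])
    then show ?thesis using tensor_scale[OF S u[OF NV] i Z \<psi>] False by simp
  qed
  then have "(\<Sum>l<k. T l (\<psi> \<odot> Z)) = (\<Sum>l<k. \<psi> * T l Z + (if l = i then R else 0))" by (intro sum.cong) auto
  also have "\<dots> = \<psi> * (\<Sum>l<k. T l Z) + R"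
    unfolding sum.distrib sum_distrib_left using i by (simp del: plus_fun_apply sum_fun_apply times_fun_apply)
  finally have 1: "(\<Sum>l<k. T l (\<psi> \<odot> Z)) = \<psi> * (\<Sum>l<k. T l Z) + R" .
  have "f Y (S (Xs[i := \<psi> \<odot> Z])) = R + \<psi> * f Y (S (Xs[i := Z]))"
    unfolding tensor_scale[OF S Xs i Z \<psi>] R_def
    by (rule vf_mult[OF f_vf[OF Y] \<psi> tensor_smooth[OF S u[OF Z]]])
  with 1 show ?thesis
    unfolding cov_tuple[OF u[OF pZ]] cov_tuple[OF u[OF Z]] T_def by (simp only: algebra_simps add_diff_cancel_left)
qed

lemma cov_tensor: "cov f N Y S \<in> tensors A k"
  by (rule tensorsI) (simp_all only: cov_smooth cov_add cov_scale)

end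

text \<open>On a tuple with equal entries at \<open>i\<close> and \<open>j\<close>, only the
  correction terms altering one of these two slots survive, and a swap shows that they
  cancel.\<close>

lemma cov_form:
  assumes \<omega>: "\<omega> \<in> forms A k" and Y: "Y \<in> V"
  shows "cov f N Y \<omega> \<in> forms A k"
proof (rule formsI[OF cov_tensor[OF forms_tensor[OF \<omega>] Y]])
  fix Xs i j assume Xs: "Xs \<in> tuples A k" and ij: "i < j" "j < k" "Xs ! i = Xs ! j"
  note len = tuples_length[OF Xs]
  define t where "t l = \<omega> (Xs[l := N Y (Xs ! l)])" for l
  have zero: "\<omega> Xs = 0" using forms_alternating[OF \<omega> Xs, of i j] ij by simp
  have "t l = 0" if "l < k" "l \<noteq> i" "l \<noteq> j" for l
    unfolding t_def using that ij forms_alternating[OF \<omega> tuples_update[OF Xs N_vf[OF Y tuples_nth[OF Xs that(1)]]], of i j]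
    by simp
  then have "(\<Sum>l<k. t l) = (\<Sum>l\<in>{i, j}. t l)"
    using ij by (intro sum.mono_neutral_right) auto
  also have "\<dots> = t i + t j" using ij by simp
  also have "t i = - t j"
  proof -
    let ?X = "Xs ! i" let ?W = "N Y ?X"
    have X: "?X \<in> V" using tuples_nth[OF Xs] ij by simp
    have "Xs[i := ?W] = Xs[i := ?W, j := ?X]" using ij by (simp add: list_update_swap[of i j])
    moreover have "Xs[j := ?W] = Xs[i := ?X, j := ?W]" by simp
    ultimately show ?thesis
      using forms_swap[OF \<omega> Xs _ ij(2) _ N_vf[OF Y X] X, of i] ij by (simp add: t_def)
  qed
  finally have "(\<Sum>l<k. t l) = 0" by (simp only: left_minus)
  then show "cov f N Y \<omega> Xs = 0"
    unfolding cov_tuple[OF Xs] t_def zero vf_zero[OF f_vf[OF Y]] by simp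
qed

lemma second_cov_form:
  assumes "\<omega> \<in> forms A k" "X \<in> V" "Y \<in> V"
  shows "second_cov f N X Y \<omega> \<in> forms A k"
  unfolding second_cov_def using assms by (intro forms_diff cov_form N_vf)

text \<open>Slot 0 is linear over the functions because \<open>f\<close> and the first argument of
  \<open>N\<close> are; the other slots are \<open>cov_add\<close> and
  \<open>cov_scale\<close>.\<close>

lemma total_cov_tensor:
  assumes S: "S \<in> tensors A k"
  shows "total_cov f N S \<in> tensors A (Suc k)"
proof (rule tensorsI)
  have split: "\<exists>Y Ys. Xs = Y # Ys \<and> Y \<in> V \<and> Ys \<in> tuples A k" if "Xs \<in> tuples A (Suc k)" for Xs
    using that by (cases Xs) (auto simp: tuples_def)
  fix Xs assume "Xs \<in> tuples A (Suc k)"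
  then obtain Y Ys where Xs: "Xs = Y # Ys" and Y: "Y \<in> V" and Ys: "Ys \<in> tuples A k" using split by blast
  show "total_cov f N S Xs \<in> C" using cov_smooth[OF S Y Ys] by (simp add: Xs total_cov_def)
  have NV: "N Q (Ys ! l) \<in> V" if "Q \<in> V" "l < k" for Q l by (rule N_vf[OF that(1) tuples_nth[OF Ys that(2)]])
  fix i Z assume i: "i < Suc k" and Z: "Z \<in> V"
  show "total_cov f N S (Xs[i := Z + W]) = total_cov f N S (Xs[i := Z]) + total_cov f N S (Xs[i := W])"
    if W: "W \<in> V" for W
  proof (cases i)
    case 0
    have "(\<Sum>l<k. S (Ys[l := N (Z + W) (Ys ! l)])) = (\<Sum>l<k. S (Ys[l := N Z (Ys ! l)]) + S (Ys[l := N W (Ys ! l)]))"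
    proof (rule sum.cong[OF refl])
      fix l assume "l \<in> {..<k}"
      then have l: "l < k" by simp
      show "S (Ys[l := N (Z + W) (Ys ! l)]) = S (Ys[l := N Z (Ys ! l)]) + S (Ys[l := N W (Ys ! l)])"
        unfolding N_add_left[OF Z W tuples_nth[OF Ys l]]
        by (rule tensor_add[OF S Ys l NV[OF Z l] NV[OF W l]])
    qed
    then have "cov f N (Z + W) S Ys = cov f N Z S Ys + cov f N W S Ys"
      unfolding cov_tuple[OF Ys] f_add[OF Z W] sum.distrib by (simp add: fun_eq_iff)
    then show ?thesis by (simp only: 0 Xs total_cov_def list_update_code list.sel)
  next
    case (Suc l)
    then show ?thesis using cov_add[OF S Y Ys _ Z W, of l] i
      by (simp only: Suc_less_eq Xs total_cov_def list_update_code list.sel)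
  qed
  show "total_cov f N S (Xs[i := \<psi> \<odot> Z]) = \<psi> * total_cov f N S (Xs[i := Z])" if \<psi>: "\<psi> \<in> C" for \<psi>
  proof (cases i)
    case 0
    have "(\<Sum>l<k. S (Ys[l := N (\<psi> \<odot> Z) (Ys ! l)])) = (\<Sum>l<k. \<psi> * S (Ys[l := N Z (Ys ! l)]))"
    proof (rule sum.cong[OF refl])
      fix l assume "l \<in> {..<k}"
      then have l: "l < k" by simp
      show "S (Ys[l := N (\<psi> \<odot> Z) (Ys ! l)]) = \<psi> * S (Ys[l := N Z (Ys ! l)])"
        unfolding N_scale_left[OF Z tuples_nth[OF Ys l] \<psi>]
        by (rule tensor_scale[OF S Ys l NV[OF Z l] \<psi>])
    qed
    then have "cov f N (\<psi> \<odot> Z) S Ys = \<psi> * cov f N Z S Ys"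
      unfolding cov_tuple[OF Ys] f_scale[OF Z \<psi>] sum_distrib_left[symmetric] by (simp add: fscale_def fun_eq_iff right_diff_distrib)
    then show ?thesis by (simp only: 0 Xs total_cov_def list_update_code list.sel)
  next
    case (Suc l)
    then show ?thesis using cov_scale[OF S Y Ys _ Z \<psi>, of l] i
      by (simp only: Suc_less_eq Xs total_cov_def list_update_code list.sel)
  qed
qed

text \<open>Freezing the trailing arguments makes the traces of 2-tensors available for the first
  two slots.\<close>

lemma tensor_append:
  assumes T: "T \<in> tensors A (m + k)" and Ys: "Ys \<in> tuples A k"
  shows "(\<lambda>Zs. T (Zs @ Ys)) \<in> tensors A m"
proof (rule tensorsI)
  fix Zs assume Zs: "Zs \<in> tuples A m"
  have app: "Zs @ Ys \<in> tuples A (m + k)" using Zs Ys by (auto simp: tuples_def)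
  show "T (Zs @ Ys) \<in> C" by (rule tensor_smooth[OF T app])
  fix i Y assume i: "i < m" and Y: "Y \<in> V"
  have i': "i < m + k" using i by simp
  have upd: "Zs[i := Q] @ Ys = (Zs @ Ys)[i := Q]" for Q using i tuples_length[OF Zs] by (simp add: list_update_append1)
  show "T (Zs[i := Y + W] @ Ys) = T (Zs[i := Y] @ Ys) + T (Zs[i := W] @ Ys)" if "W \<in> V" for W
    unfolding upd by (rule tensor_add[OF T app i' Y that])
  show "T (Zs[i := \<psi> \<odot> Y] @ Ys) = \<psi> * T (Zs[i := Y] @ Ys)" if "\<psi> \<in> C" for \<psi>
    unfolding upd by (rule tensor_scale[OF T app i' Y that])
qed

lemma tuples_Cons: "Y \<in> V \<Longrightarrow> Ys \<in> tuples A k \<Longrightarrow> Y # Ys \<in> tuples A (Suc k)"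
  by (auto simp: tuples_def)

section \<open>Covariant derivatives of traces and of exterior \<open>f\<close>-derivatives\<close>

lemma adjoint_cov_at:
  assumes Ys: "Ys \<in> tuples A k"
  shows "adjoint_cov A g f N' S Ys p =
    - (\<Sum>i<DIM('e). cov f N (frame A g p i) S (frame A g p i # Ys) p)"
  unfolding adjoint_cov_def using cov_dual[OF tuples_Cons[OF frame_vf Ys] frame_vf] by simp

lemma adjoint_cov_trace:
  assumes Ys: "Ys \<in> tuples A k"
  shows "adjoint_cov A g f N' S Ys = - metric_trace (\<lambda>Zs. total_cov f N S (Zs @ Ys))"
  by (rule ext) (simp add: adjoint_cov_at[OF Ys] metric_trace_def total_cov_def)

text \<open>The correction terms in \<open>vf_metric_trace\<close> are exactly those that
  \<open>cov f N X T\<close> has for the two traced slots, so the derivative passes through the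
  trace; \<open>cov_total_cov\<close> then turns the derivative of \<open>T\<close> into
  \<open>second_cov\<close>.\<close>

lemma cov_adjoint_cov:
  assumes S: "S \<in> tensors A (Suc k)" and X: "X \<in> V" and Ys: "Ys \<in> tuples A k"
  defines "e \<equiv> frame A g"
  shows "cov f N X (adjoint_cov A g f N' S) Ys p
    = - (\<Sum>i<DIM('e). second_cov f N X (e p i) S (e p i # Ys) p)"
proof -
  define T where "T = total_cov f N S"
  have T: "T \<in> tensors A (2 + k)" unfolding T_def using total_cov_tensor[OF S] by simp
  have T2: "(\<lambda>Zs. T (Zs @ Ys)) \<in> tensors A 2" by (rule tensor_append[OF T Ys])
  have fX: "f X \<in> V" by (rule f_vf[OF X])
  have NX: "N X Y \<in> V" if "Y \<in> V" for Y by (rule N_vf[OF X that])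
  have u: "Ys[l := N X (Ys ! l)] \<in> tuples A k" if "l < k" for l
    by (rule tuples_update[OF Ys NX[OF tuples_nth[OF Ys that]]])
  have "f X (adjoint_cov A g f N' S Ys) = - f X (metric_trace (\<lambda>Zs. T (Zs @ Ys)))"
    unfolding adjoint_cov_trace[OF Ys] T_def[symmetric]
    by (rule vf_uminus[OF fX metric_trace_smooth[OF T2]])
  moreover have tr: "f X (metric_trace (\<lambda>Zs. T (Zs @ Ys))) p = (\<Sum>i<DIM('e).
      (f X (T ([e p i, e p i] @ Ys)) - T ([N X (e p i), e p i] @ Ys) - T ([e p i, N X (e p i)] @ Ys)) p)"
    unfolding e_def using NX N_metric[OF X] by (intro vf_metric_trace[where L = "N X", OF T2 fX])
  ultimately have "f X (adjoint_cov A g f N' S Ys) p = - f X (metric_trace (\<lambda>Zs. T (Zs @ Ys))) p"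
    by simp
  then have 1: "f X (adjoint_cov A g f N' S Ys) p = - (\<Sum>i<DIM('e). (f X (T (e p i # e p i # Ys))
      - T (N X (e p i) # e p i # Ys) - T (e p i # N X (e p i) # Ys)) p)"
    unfolding tr by simp
  have 2: "adjoint_cov A g f N' S (Ys[l := N X (Ys ! l)]) p
      = - (\<Sum>i<DIM('e). T (e p i # e p i # Ys[l := N X (Ys ! l)]) p)" if "l < k" for l
    using adjoint_cov_trace[OF u[OF that], of S] by (simp add: metric_trace_def T_def e_def)
  have 3: "cov f N X T (Y # Y # Ys) p = (f X (T (Y # Y # Ys)) - T (N X Y # Y # Ys) - T (Y # N X Y # Ys)) p
      - (\<Sum>l<k. T (Y # Y # Ys[l := N X (Ys ! l)]) p)" for Y
    by (simp add: cov_def tuples_length[OF Ys] sum.lessThan_Suc_shift del: sum.lessThan_Suc)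
  have "cov f N X (adjoint_cov A g f N' S) Ys p = - (\<Sum>i<DIM('e). cov f N X T (e p i # e p i # Ys) p)"
    unfolding cov_tuple[OF Ys] 3 sum_subtractf using 1 2
    by (simp add: sum_negf sum_subtractf sum.swap[of _ "{..<k}"])
  then show ?thesis unfolding T_def cov_total_cov .
qed

text \<open>The derivation \<open>f Y\<close> passes through the constant signs, and
  \<open>sum_move_front\<close> lets the correction terms pass through each rearrangement of the
  arguments.\<close>

lemma cov_ext_f_derivative:
  assumes S: "S \<in> tensors A k" and Y: "Y \<in> V" and Xs: "Xs \<in> tuples A (Suc k)"
  shows "cov f N Y (ext_f_derivative f N S) Xs p
    = (\<Sum>j<Suc k. (- 1) ^ j * cov f N Y (total_cov f N S) (move_front j Xs) p)"
proof -
  define T where "T = total_cov f N S"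
  have T: "T \<in> tensors A (Suc k)" unfolding T_def by (rule total_cov_tensor[OF S])
  note len = tuples_length[OF Xs]
  have mf: "move_front j Xs \<in> tuples A (Suc k)" if "j < Suc k" for j
    using that Xs set_take_subset[of j Xs] set_drop_subset[of "Suc j" Xs]
    by (auto simp: tuples_def)
  have d: "ext_f_derivative f N S Zs = (\<Sum>j<Suc k. (\<lambda>_. (- 1) ^ j) * T (move_front j Zs))"
    if "length Zs = Suc k" for Zs
    using that by (simp only: ext_f_derivative_def T_def minus_one_power_fun)
  have "f Y (ext_f_derivative f N S Xs) = (\<Sum>j<Suc k. f Y ((\<lambda>_. (- 1) ^ j) * T (move_front j Xs)))"
    unfolding d[OF len] by (rule vf_sum[OF f_vf[OF Y]]) (intro smooth_mult smooth_const tensor_smooth[OF T] mf, simp)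
  also have "\<dots> = (\<Sum>j<Suc k. (\<lambda>_. (- 1) ^ j) * f Y (T (move_front j Xs)))"
    by (intro sum.cong refl vf_cmult[OF f_vf[OF Y]] tensor_smooth[OF T] mf) simp
  finally have 1: "f Y (ext_f_derivative f N S Xs) p = (\<Sum>j<Suc k. (- 1) ^ j * f Y (T (move_front j Xs)) p)"
    by simp
  have "(\<Sum>l<Suc k. ext_f_derivative f N S (Xs[l := N Y (Xs ! l)]) p)
      = (\<Sum>l<Suc k. \<Sum>j<Suc k. (- 1) ^ j * T (move_front j (Xs[l := N Y (Xs ! l)])) p)"
    by (intro sum.cong refl) (subst d, simp add: len, simp)
  also have "\<dots> = (\<Sum>j<Suc k. \<Sum>l<Suc k. (- 1) ^ j * T (move_front j (Xs[l := N Y (Xs ! l)])) p)"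
    by (rule sum.swap)
  also have "\<dots> = (\<Sum>j<Suc k. \<Sum>l<Suc k. (- 1) ^ j * T ((move_front j Xs)[l := N Y (move_front j Xs ! l)]) p)"
  proof (rule sum.cong[OF refl])
    fix j assume "j \<in> {..<Suc k}"
    then have "j < length Xs" using len by simp
    from sum_move_front[OF this, of "\<lambda>Zs. (- 1) ^ j * T Zs p" "N Y"]
    show "(\<Sum>l<Suc k. (- 1) ^ j * T (move_front j (Xs[l := N Y (Xs ! l)])) p) =
        (\<Sum>l<Suc k. (- 1) ^ j * T ((move_front j Xs)[l := N Y (move_front j Xs ! l)]) p)"
      unfolding len .
  qed
  finally have 2: "(\<Sum>l<Suc k. ext_f_derivative f N S (Xs[l := N Y (Xs ! l)]) p)
      = (\<Sum>j<Suc k. (- 1) ^ j * (\<Sum>l<Suc k. T ((move_front j Xs)[l := N Y (move_front j Xs ! l)]) p))"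
    unfolding sum_distrib_left .
  have "cov f N Y (ext_f_derivative f N S) Xs p
      = (\<Sum>j<Suc k. (- 1) ^ j * (f Y (T (move_front j Xs)) p
          - (\<Sum>l<Suc k. T ((move_front j Xs)[l := N Y (move_front j Xs ! l)]) p)))"
    unfolding cov_tuple[OF Xs] right_diff_distrib sum_subtractf 1[symmetric] 2[symmetric]
    by (simp del: sum.lessThan_Suc)
  also have "\<dots> = (\<Sum>j<Suc k. (- 1) ^ j * cov f N Y T (move_front j Xs) p)"
    by (intro sum.cong refl) (simp add: cov_tuple[OF mf] del: sum.lessThan_Suc)
  finally show ?thesis unfolding T_def .
qed

theorem weitzenboeck_formula:
  assumes \<omega>: "\<omega> \<in> forms A k" and Xs: "Xs \<in> tuples A k"
  shows "hodge_f_laplacian A g f N N' k \<omega> Xs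
     = adjoint_cov A g f N' (total_cov f N \<omega>) Xs + weitzenboeck A g f N \<omega> Xs"
proof (rule ext)
  fix p
  define e where "e = frame A g p"
  define Q where "Q X Y = second_cov f N X Y \<omega>" for X Y
  note len = tuples_length[OF Xs]
  note S = forms_tensor[OF \<omega>]
  have eV: "e i \<in> V" if "i < DIM('e)" for i unfolding e_def by (rule frame_vf[OF that])
  have XV: "Xs ! a \<in> V" if "a < k" for a by (rule tuples_nth[OF Xs that])
  have front: "Q X Y (Z # take a Xs @ drop (Suc a) Xs) p = (- 1) ^ a * Q X Y (Xs[a := Z]) p"
    if "X \<in> V" "Y \<in> V" "Z \<in> V" "a < k" for X Y Z a
    unfolding Q_def by (rule forms_move_front[OF second_cov_form[OF \<omega> that(1,2)] that(3) Xs that(4)])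
  \<comment> \<open>One sign comes from the alternating sum, the other from moving
    \<open>e i\<close> into slot \<open>a\<close>; they cancel in both halves of the
    Laplacian.\<close>
  have sgn: "(- 1) ^ a * ((- 1) ^ a * r) = r" for a and r :: real
    by (simp add: mult.assoc[symmetric] power_mult_distrib[symmetric])
  have "codifferential A g f N' (Suc k) (ext_f_derivative f N \<omega>) Xs p
      = - (\<Sum>i<DIM('e). \<Sum>j<Suc k. (- 1) ^ j * cov f N (e i) (total_cov f N \<omega>) (move_front j (e i # Xs)) p)"
    unfolding codifferential_def using adjoint_cov_at[OF Xs] cov_ext_f_derivative[OF S eV tuples_Cons[OF eV Xs]]
    by (simp add: e_def del: sum.lessThan_Suc)
  \<comment> \<open>The summand \<open>j = 0\<close> gives the rough Laplacian. The summand
    \<open>j = Suc a\<close> has one sign more than the move into slot \<open>a\<close> needs,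
    whence the minus.\<close>
  also have "\<dots> = - (\<Sum>i<DIM('e). cov f N (e i) (total_cov f N \<omega>) (e i # Xs) p
      - (\<Sum>a<k. Q (e i) (Xs ! a) (Xs[a := e i]) p))"
  proof (intro arg_cong[of _ _ uminus] sum.cong refl)
    fix i assume "i \<in> {..<DIM('e)}"
    then have i: "i < DIM('e)" by simp
    have "(- 1) ^ Suc a * cov f N (e i) (total_cov f N \<omega>) (move_front (Suc a) (e i # Xs)) p
        = - Q (e i) (Xs ! a) (Xs[a := e i]) p" if a: "a < k" for a
    proof -
      have "cov f N (e i) (total_cov f N \<omega>) (move_front (Suc a) (e i # Xs)) p
          = Q (e i) (Xs ! a) (e i # take a Xs @ drop (Suc a) Xs) p"
        unfolding Q_def cov_total_cov by simp
      then show ?thesis using front[OF eV[OF i] XV[OF a] eV[OF i] a] sgn[of a] by simp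
    qed
    then show "(\<Sum>j<Suc k. (- 1) ^ j * cov f N (e i) (total_cov f N \<omega>) (move_front j (e i # Xs)) p)
        = cov f N (e i) (total_cov f N \<omega>) (e i # Xs) p - (\<Sum>a<k. Q (e i) (Xs ! a) (Xs[a := e i]) p)"
      unfolding sum.lessThan_Suc_shift by (simp add: sum_negf)
  qed
  also have "\<dots> = adjoint_cov A g f N' (total_cov f N \<omega>) Xs p
      + (\<Sum>i<DIM('e). \<Sum>a<k. Q (e i) (Xs ! a) (Xs[a := e i]) p)"
    using adjoint_cov_at[OF Xs, of "total_cov f N \<omega>" p] by (simp add: e_def sum_subtractf)
  finally have 1: "codifferential A g f N' (Suc k) (ext_f_derivative f N \<omega>) Xs p
      = adjoint_cov A g f N' (total_cov f N \<omega>) Xs p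
        + (\<Sum>i<DIM('e). \<Sum>a<k. Q (e i) (Xs ! a) (Xs[a := e i]) p)" .
  \<comment> \<open>Here \<open>Xs ! a\<close> is the outer direction of differentiation. Since
    \<open>a < k\<close>, the degree is positive and \<open>codifferential\<close> is the trace, not
    its default 0; in degree 0 the sum over \<open>a\<close> is empty.\<close>
  have "total_cov f N (codifferential A g f N' k \<omega>) (move_front a Xs) p
      = - (\<Sum>i<DIM('e). (- 1) ^ a * Q (Xs ! a) (e i) (Xs[a := e i]) p)" if a: "a < k" for a
  proof -
    obtain k' where k': "k = Suc k'" using a by (cases k) auto
    have del: "take a Xs @ drop (Suc a) Xs \<in> tuples A k'"
      using Xs a k' set_take_subset[of a Xs] set_drop_subset[of "Suc a" Xs] by (auto simp: tuples_def)
    have "total_cov f N (codifferential A g f N' k \<omega>) (move_front a Xs) p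
        = cov f N (Xs ! a) (adjoint_cov A g f N' \<omega>) (take a Xs @ drop (Suc a) Xs) p"
      by (simp add: total_cov_def codifferential_def k')
    also have "\<dots> = - (\<Sum>i<DIM('e). Q (Xs ! a) (e i) (e i # take a Xs @ drop (Suc a) Xs) p)"
      using cov_adjoint_cov[OF _ XV[OF a] del] S by (simp add: k' Q_def e_def)
    finally show ?thesis using front[OF XV[OF a] eV eV a] by simp
  qed
  then have "ext_f_derivative f N (codifferential A g f N' k \<omega>) Xs p
      = (\<Sum>a<k. (- 1) ^ a * - (\<Sum>i<DIM('e). (- 1) ^ a * Q (Xs ! a) (e i) (Xs[a := e i]) p))"
    by (simp add: ext_f_derivative_def len minus_one_power_fun)
  also have "\<dots> = - (\<Sum>a<k. \<Sum>i<DIM('e). Q (Xs ! a) (e i) (Xs[a := e i]) p)"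
    by (simp add: sum_distrib_left sgn sum_negf)
  finally have 2: "ext_f_derivative f N (codifferential A g f N' k \<omega>) Xs p
      = - (\<Sum>a<k. \<Sum>i<DIM('e). Q (Xs ! a) (e i) (Xs[a := e i]) p)" .
  have 3: "weitzenboeck A g f N \<omega> Xs p = (\<Sum>a<k. \<Sum>i<DIM('e). Q (e i) (Xs ! a) (Xs[a := e i]) p)
      - (\<Sum>a<k. \<Sum>i<DIM('e). Q (Xs ! a) (e i) (Xs[a := e i]) p)"
    by (simp add: weitzenboeck_def f_curvature_def len e_def Q_def sum_subtractf)
  show "hodge_f_laplacian A g f N N' k \<omega> Xs p
     = (adjoint_cov A g f N' (total_cov f N \<omega>) Xs + weitzenboeck A g f N \<omega> Xs) p"
    unfolding hodge_f_laplacian_def plus_fun_apply 1 2 3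
    by (simp add: sum.swap[of _ "{..<k}" "{..<DIM('e)}"])
qed

end

section \<open>The given connections as an instance of a metric \<open>f\<close>-connection\<close>

theorem theorem3:
  fixes A :: "('m::{t2_space,second_countable_topology}, 'e::euclidean_space) atlas"
    and g F G \<omega> :: "'m tensor"
    and f :: "'m vfield \<Rightarrow> 'm vfield"
    and nabla_g nabla nabla_f nabla_f' :: "'m connection"
    and k :: nat
  assumes manifold: "smooth_manifold A"
    and metric: "riemannian_metric A g"
    and skew: "F \<in> forms A 2"
    and nonzero: "\<exists>X\<in>vector_fields A. \<exists>Y\<in>vector_fields A. F [X, Y] \<noteq> 0"
    and G: "G = g + F"
    and f_tensor: "f \<in> endomorphisms A"
    and f: "\<And>X Y. \<lbrakk>X \<in> vector_fields A; Y \<in> vector_fields A\<rbrakk> \<Longrightarrow> g [X, f Y] = F [X, Y]"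
    and levi_civita: "levi_civita A g nabla_g"
    and einstein: "einstein_connection A G nabla"
    and nabla_metric: "metric_connection A g nabla"
    and torsion: "\<And>X Y Z. \<lbrakk>X \<in> vector_fields A; Y \<in> vector_fields A; Z \<in> vector_fields A\<rbrakk> \<Longrightarrow>
       g [torsion nabla X Y, Z] + g [torsion nabla X Z, Y]
       + g [torsion nabla X Z, f Y] + g [torsion nabla X Y, f Z] = 0"
    and nabla_f: "nabla_f = f_connection f nabla_g nabla"
    and nabla_f': "nabla_f' = dual_f_connection A g f nabla_g nabla"
    and form: "\<omega> \<in> forms A k"
  shows "\<forall>Xs\<in>tuples A k.
     hodge_f_laplacian A g f nabla_f nabla_f' k \<omega> Xs
     = adjoint_cov A g f nabla_f' (total_cov f nabla_f \<omega>) Xs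
       + weitzenboeck A g f nabla_f \<omega> Xs"
proof -
  interpret riemannian A g by unfold_locales (fact manifold, fact metric)
  have fV: "f X \<in> V" if "X \<in> V" for X using f_tensor that unfolding endomorphisms_def by simp
  have f_add: "f (X + Y) = f X + f Y" if "X \<in> V" "Y \<in> V" for X Y
    using f_tensor that unfolding endomorphisms_def by simp
  have f_scale: "f (\<psi> \<odot> X) = \<psi> \<odot> f X" if "X \<in> V" "\<psi> \<in> C" for X \<psi>
    using f_tensor that unfolding endomorphisms_def by simp
  have conn: "linear_connection A nabla_g" "linear_connection A nabla"
    by (rule levi_civita[unfolded levi_civita_def, THEN conjunct1],
        rule einstein[unfolded einstein_connection_def, THEN conjunct1])
  have metric_conn: "metric_connection A g nabla_g" "metric_connection A g nabla"
    by (rule levi_civita[unfolded levi_civita_def, THEN conjunct2, THEN conjunct1], rule nabla_metric)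
  have D_vf: "D X Y \<in> V" if "linear_connection A D" "X \<in> V" "Y \<in> V" for D X Y
    using that(1)[unfolded linear_connection_def, THEN bspec, OF that(2), THEN bspec, OF that(3)] by simp
  have D_add: "D (X + Y) Z = D X Z + D Y Z" "D X (Y + Z) = D X Y + D X Z"
    if "linear_connection A D" "X \<in> V" "Y \<in> V" "Z \<in> V" for D X Y Z
    using that(1)[unfolded linear_connection_def, THEN bspec, OF that(2), THEN bspec, OF that(3)] that(4) by simp_all
  have D_scale: "D (\<psi> \<odot> X) Y = \<psi> \<odot> D X Y" "D X (\<psi> \<odot> Y) = X \<psi> \<odot> Y + \<psi> \<odot> D X Y"
    if "linear_connection A D" "X \<in> V" "Y \<in> V" "\<psi> \<in> C" for D X Y \<psi>
    using that(1)[unfolded linear_connection_def, THEN bspec, OF that(2), THEN bspec, OF that(3)] that(4) by simp_all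
  have D_metric: "X (g [Y, Z]) = g [D X Y, Z] + g [Y, D X Z]"
    if "metric_connection A g D" "X \<in> V" "Y \<in> V" "Z \<in> V" for D X Y Z
  proof -
    have "cov id D X g [Y, Z] = 0" using that unfolding metric_connection_def by blast
    then show ?thesis by (simp add: cov_def sum.lessThan_Suc_shift numeral_2_eq_2 del: sum.lessThan_Suc)
  qed
  define K where "K = difference nabla_g nabla"
  have KV: "K X Y \<in> V" if "X \<in> V" "Y \<in> V" for X Y
    unfolding K_def difference_def by (intro vector_fields_diff D_vf[OF conn(1)] D_vf[OF conn(2)] that)
  have K_skew: "g [K X Y, Z] + g [Y, K X Z] = 0" if "X \<in> V" "Y \<in> V" "Z \<in> V" for X Y Z
  proof -
    note v = D_vf[OF conn(1) that(1)] D_vf[OF conn(2) that(1)]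
    have "g [K X Y, Z] = g [nabla X Y, Z] - g [nabla_g X Y, Z]"
      unfolding K_def difference_def by (intro g_diff_left v that)
    moreover have "g [Y, K X Z] = g [Y, nabla X Z] - g [Y, nabla_g X Z]"
      unfolding K_def difference_def
      using g_sym[OF that(2)] g_diff_left[OF v(2,1)[OF that(3)] that(2)] v[OF that(3)]
        vector_fields_diff[OF v(2,1)[OF that(3)]] by simp
    moreover have "g [nabla X Y, Z] + g [Y, nabla X Z] = g [nabla_g X Y, Z] + g [Y, nabla_g X Z]"
      using D_metric[OF metric_conn(1) that] D_metric[OF metric_conn(2) that] by simp
    ultimately show ?thesis by (simp only: add_diff_add[symmetric] diff_self)
  qed
  have nabla_f_eq: "nabla_f X Y = nabla_g (f X) Y + K X Y" for X Y
    by (simp add: nabla_f f_connection_def K_def)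
  \<comment> \<open>\<open>metric_adjoint\<close> is a definite description: skewness makes
    \<open>- K X Y\<close> a candidate, nondegeneracy of \<open>g\<close> the only one. The minus
    sign in \<open>dual_f_connection\<close> then restores \<open>K\<close>.\<close>
  have adjoint: "metric_adjoint A g (K X) Y = - K X Y" if X: "X \<in> V" and Y: "Y \<in> V" for X Y
    unfolding metric_adjoint_def
  proof (rule the_equality)
    have neg: "- K X Y \<in> V" by (rule vector_fields_uminus[OF KV[OF X Y]])
    have eq: "g [- K X Y, Z] = g [Y, K X Z]" if "Z \<in> V" for Z
      using minus_unique[OF K_skew[OF X Y that]] g_uminus_left[OF KV[OF X Y] that] by (simp only:)
    show "- K X Y \<in> V \<and> (\<forall>Z\<in>V. g [- K X Y, Z] = g [Y, K X Z])" using neg eq by blast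
    fix W assume W: "W \<in> V \<and> (\<forall>Z\<in>V. g [W, Z] = g [Y, K X Z])"
    have "W - (- K X Y) = 0"
    proof (rule g_nondegenerate)
      show "W - (- K X Y) \<in> V" using W neg by (intro vector_fields_diff) auto
      fix Z assume Z: "Z \<in> V"
      then have "g [W, Z] = g [Y, K X Z]" using W by blast
      with g_diff_left[OF conjunct1[OF W] neg Z] eq[OF Z] show "g [W - (- K X Y), Z] = 0"
        by (simp only: diff_self)
    qed
    then show "W = - K X Y" by (rule right_minus_eq[THEN iffD1])
  qed
  interpret metric_f_connection A g f nabla_f nabla_f'
  proof
    show "f \<in> endomorphisms A" by (fact f_tensor)
    fix X Y assume X: "X \<in> V" and Y: "Y \<in> V"
    show "nabla_f X Y \<in> V" unfolding nabla_f_eq by (intro vector_fields_add D_vf[OF conn(1)] fV KV X Y)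
    show "nabla_f' X Y = nabla_f X Y"
      using adjoint[OF X Y] by (simp add: nabla_f' dual_f_connection_def nabla_f_eq K_def)
    fix \<psi> assume \<psi>: "\<psi> \<in> C"
    show "nabla_f (\<psi> \<odot> X) Y = \<psi> \<odot> nabla_f X Y"
      unfolding nabla_f_eq K_def difference_def f_scale[OF X \<psi>] D_scale(1)[OF conn(1) fV[OF X] Y \<psi>]
        D_scale(1)[OF conn(1) X Y \<psi>] D_scale(1)[OF conn(2) X Y \<psi>]
      by (simp add: fscale_def fun_eq_iff algebra_simps)
    \<comment> \<open>In \<open>K\<close> the terms \<open>X \<psi> \<odot> Y\<close> of the two
      connections cancel; the remaining derivative of \<open>\<psi>\<close> comes from
      \<open>nabla_g\<close> along \<open>f X\<close>.\<close>
    show "nabla_f X (\<psi> \<odot> Y) = f X \<psi> \<odot> Y + \<psi> \<odot> nabla_f X Y"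
      unfolding nabla_f_eq K_def difference_def D_scale(2)[OF conn(1) fV[OF X] Y \<psi>]
        D_scale(2)[OF conn(1) X Y \<psi>] D_scale(2)[OF conn(2) X Y \<psi>]
      by (simp add: fscale_def fun_eq_iff algebra_simps)
  next
    fix X Y Z assume X: "X \<in> V" and Y: "Y \<in> V" and Z: "Z \<in> V"
    show "nabla_f (X + Y) Z = nabla_f X Z + nabla_f Y Z"
      unfolding nabla_f_eq K_def difference_def f_add[OF X Y] D_add(1)[OF conn(1) fV[OF X] fV[OF Y] Z]
        D_add(1)[OF conn(1) X Y Z] D_add(1)[OF conn(2) X Y Z] by (simp add: algebra_simps)
    show "nabla_f X (Y + Z) = nabla_f X Y + nabla_f X Z"
      unfolding nabla_f_eq K_def difference_def D_add(2)[OF conn(1) fV[OF X] Y Z]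
        D_add(2)[OF conn(1) X Y Z] D_add(2)[OF conn(2) X Y Z] by (simp add: algebra_simps)
    have "g [nabla_f X Y, Z] = g [nabla_g (f X) Y, Z] + g [K X Y, Z]"
      unfolding nabla_f_eq by (intro g_add_left D_vf[OF conn(1)] fV KV X Y Z)
    moreover have "g [Y, nabla_f X Z] = g [Y, nabla_g (f X) Z] + g [Y, K X Z]"
      unfolding nabla_f_eq
      using g_add_left[OF D_vf[OF conn(1) fV[OF X] Z] KV[OF X Z] Y] g_sym[OF Y]
        D_vf[OF conn(1) fV[OF X] Z] KV[OF X Z] vector_fields_add[OF D_vf[OF conn(1) fV[OF X] Z] KV[OF X Z]]
      by (simp del: plus_fun_apply)
    \<comment> \<open>The left side is metricity of \<open>nabla_g\<close> along \<open>f X\<close>;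
      the two contributions of \<open>K\<close> cancel by skewness.\<close>
    ultimately show "f X (g [Y, Z]) = g [nabla_f X Y, Z] + g [Y, nabla_f X Z]"
      using D_metric[OF metric_conn(1) fV[OF X] Y Z] K_skew[OF X Y Z]
      by (simp only: add.assoc add.left_commute[of "g [K X Y, Z]"] add_0_right)
  qed
  show ?thesis using weitzenboeck_formula[OF form] by blast
qed

end
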